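(* Let $Y=\operatorname{Susp}(X,f,k_1,\dots,k_m)$ be an $m$-suspension over $X$, and assume $Y$ is irreducible. Then the following hold. (1) If $k_i=1$ for all $i$ and $f\in\mathbb{K}[X]\setminus \operatorname{ML}(X)$, then $\operatorname{ML}(Y)\subset \pi(\operatorname{ML}_f(X))$. (2) If there exist $i,j$ with $k_i=1$ and $k_j>1$, and $f$ is a local slice of $X$, then $\operatorname{ML}(Y)\subset \pi(\operatorname{ML}_f(X))$. (3) If $k_i>1$ for all $i$ and $f$ is a local slice of $X$, then $\operatorname{ML}(Y)\subset \pi\big(\mathbb{K}[X]^{\mathcal{G}^{(1)}_f}\big)$.
   Context: $\mathbb{K}$ is an algebraically closed field of characteristic zero and $X$ is an irreducible affine algebraic variety over $\mathbb{K}$. For an affine variety $Z$, $\operatorname{LND}(Z)$ is the set of locally nilpotent ($\mathbb{K}$-linear) derivations of $\mathbb{K}[Z]$, and $\operatorname{ML}(Z)=\bigcap_{\delta\in\operatorname{LND}(Z)}\operatorname{Ker}\delta$ is the Makar-Limanov invariant. Given $m\ge 1$, $f\in\mathbb{K}[X]\setminus\mathbb{K}$ and positive integers $k_1,\dots,k_m$, the $m$-suspension is $\operatorname{Susp}(X,f,k_1,\dots,k_m)=\{y_1^{k_1}\cdots y_m^{k_m}=f(x)\}\subset X\times\mathbb{A}^m$, with coordinate ring $\mathbb{K}[Y]=\mathbb{K}[X][y_1,\dots,y_m]/(y_1^{k_1}\cdots y_m^{k_m}-f)$. The map $\pi:\mathbb{K}[X\times\mathbb{A}^m]\to\mathbb{K}[Y]$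 is the quotient map, and subalgebras of $\mathbb{K}[X]$ are regarded as subalgebras of $\mathbb{K}[X\times\mathbb{A}^m]$ via the natural embedding. An element $f\in\mathbb{K}[X]$ is a local slice of $X$ if there is $\delta\in\operatorname{LND}(X)$ with $\delta(f)\ne0$ and $\delta^2(f)=0$. For $f\in\mathbb{K}[X]\setminus\operatorname{ML}(X)$, $\operatorname{ML}_f(X)=\bigcap_{\delta\in\operatorname{LND}(X),\,\delta(f)\ne 0}\operatorname{Ker}\delta$. For $\delta\in\operatorname{LND}(X)$ and $a\neq 0$, $\deg_\delta a=\min\{n\ge 0:\delta^{n+1}(a)=0\}$. Put $\mathcal{N}^{(1)}_f=\{\delta\in\operatorname{LND}(X):\deg_\delta f=1\}\cup\{0\}$, and let $\mathcal{G}^{(1)}_f\subseteq\operatorname{Aut}(X)$ be the group generated by all one-parameter subgroups $\{\exp(s\delta):s\in\mathbb{K}\}$ with $\delta\in\mathcal{N}^{(1)}_f$; $\mathbb{K}[X]^{\mathcal{G}^{(1)}_f}$ is its algebra of regular invariants. *)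

theory Defs
  imports
    "HOL-Library.Function_Algebras"
    "HOL-Library.Nat_Bijection"
    "HOL-Computational_Algebra.Polynomial"
    "HOL-Algebra.Generated_Groups"
    "HOL-Algebra.Bij"
begin

section \<open>Affine varieties and their coordinate rings\<close>

text \<open>
  The affine space with coordinates indexed by a finite type \<open>'i\<close> is the type \<open>'i \<Rightarrow> 'k\<close>.
  Sums and products of functions are the pointwise ones.
\<close>

inductive_set poly_funs :: "(('i \<Rightarrow> 'k :: comm_ring_1) \<Rightarrow> 'k) set" where
  const: "(\<lambda>_. c) \<in> poly_funs"
| coord: "(\<lambda>x. x i) \<in> poly_funs"
| add: "p \<in> poly_funs \<Longrightarrow> q \<in> poly_funs \<Longrightarrow> p + q \<in> poly_funs"
| mult: "p \<in> poly_funs \<Longrightarrow> q \<in> poly_funs \<Longrightarrow> p * q \<in> poly_funs"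

definition zariski_closed :: "('i \<Rightarrow> 'k :: comm_ring_1) set \<Rightarrow> bool" where
  "zariski_closed Z \<longleftrightarrow> (\<exists>S \<subseteq> poly_funs. Z = {x. \<forall>p\<in>S. p x = 0})"

definition zariski_irreducible :: "('i \<Rightarrow> 'k :: comm_ring_1) set \<Rightarrow> bool" where
  "zariski_irreducible Z \<longleftrightarrow> Z \<noteq> {} \<and>
     (\<forall>A B. zariski_closed A \<longrightarrow> zariski_closed B \<longrightarrow> Z \<subseteq> A \<union> B \<longrightarrow> Z \<subseteq> A \<or> Z \<subseteq> B)"

text \<open>
  Functions on \<open>Z\<close> are encoded by functions on the ambient space vanishing outside \<open>Z\<close>;
  so \<open>0\<close>, \<open>+\<close> and \<open>*\<close> of the coordinate ring are those of the type, and \<open>on_var Z (\<lambda>_. c)\<close> is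
  the scalar \<open>c\<close>.
\<close>

definition on_var :: "'p set \<Rightarrow> ('p \<Rightarrow> 'k :: comm_ring_1) \<Rightarrow> ('p \<Rightarrow> 'k)" where
  "on_var Z h = (\<lambda>x. if x \<in> Z then h x else 0)"

definition coord_ring :: "('i \<Rightarrow> 'k :: comm_ring_1) set \<Rightarrow> (('i \<Rightarrow> 'k) \<Rightarrow> 'k) set" where
  "coord_ring Z = on_var Z ` poly_funs"

definition scalars :: "('i \<Rightarrow> 'k :: comm_ring_1) set \<Rightarrow> (('i \<Rightarrow> 'k) \<Rightarrow> 'k) set" where
  "scalars Z = {on_var Z (\<lambda>_. c) | c. True}"

definition scale :: "'k :: comm_ring_1 \<Rightarrow> ('p \<Rightarrow> 'k) \<Rightarrow> ('p \<Rightarrow> 'k)" where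
  "scale c a = (\<lambda>x. c * a x)"


section \<open>Locally nilpotent derivations\<close>

definition LND :: "('i \<Rightarrow> 'k :: comm_ring_1) set \<Rightarrow>
    ((('i \<Rightarrow> 'k) \<Rightarrow> 'k) \<Rightarrow> (('i \<Rightarrow> 'k) \<Rightarrow> 'k)) set" where
  "LND Z = {\<delta> \<in> coord_ring Z \<rightarrow>\<^sub>E coord_ring Z.
     (\<forall>a\<in>coord_ring Z. \<forall>b\<in>coord_ring Z. \<delta> (a + b) = \<delta> a + \<delta> b) \<and>
     (\<forall>c. \<forall>a\<in>coord_ring Z. \<delta> (scale c a) = scale c (\<delta> a)) \<and>
     (\<forall>a\<in>coord_ring Z. \<forall>b\<in>coord_ring Z. \<delta> (a * b) = \<delta> a * b + a * \<delta> b) \<and>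
     (\<forall>a\<in>coord_ring Z. \<exists>n. (\<delta> ^^ n) a = 0)}"

definition Ker :: "('i \<Rightarrow> 'k :: comm_ring_1) set \<Rightarrow>
    ((('i \<Rightarrow> 'k) \<Rightarrow> 'k) \<Rightarrow> (('i \<Rightarrow> 'k) \<Rightarrow> 'k)) \<Rightarrow> (('i \<Rightarrow> 'k) \<Rightarrow> 'k) set" where
  "Ker Z \<delta> = {a \<in> coord_ring Z. \<delta> a = 0}"

definition makar_limanov :: "('i \<Rightarrow> 'k :: comm_ring_1) set \<Rightarrow> (('i \<Rightarrow> 'k) \<Rightarrow> 'k) set" where
  "makar_limanov Z = (\<Inter>\<delta>\<in>LND Z. Ker Z \<delta>)"

definition makar_limanov_at :: "('i \<Rightarrow> 'k :: comm_ring_1) set \<Rightarrow> (('i \<Rightarrow> 'k) \<Rightarrow> 'k) \<Rightarrow>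
    (('i \<Rightarrow> 'k) \<Rightarrow> 'k) set" where
  "makar_limanov_at Z f = (\<Inter>\<delta>\<in>{\<delta> \<in> LND Z. \<delta> f \<noteq> 0}. Ker Z \<delta>)"

definition local_slice :: "('i \<Rightarrow> 'k :: comm_ring_1) set \<Rightarrow> (('i \<Rightarrow> 'k) \<Rightarrow> 'k) \<Rightarrow> bool" where
  "local_slice Z f \<longleftrightarrow> f \<in> coord_ring Z \<and> (\<exists>\<delta>\<in>LND Z. \<delta> f \<noteq> 0 \<and> \<delta> (\<delta> f) = 0)"

text \<open>This is the degree only at \<open>a \<noteq> 0\<close>.\<close>

definition lnd_degree :: "((('i \<Rightarrow> 'k :: comm_ring_1) \<Rightarrow> 'k) \<Rightarrow> (('i \<Rightarrow> 'k) \<Rightarrow> 'k)) \<Rightarrow>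
    (('i \<Rightarrow> 'k) \<Rightarrow> 'k) \<Rightarrow> nat" where
  "lnd_degree \<delta> a = (LEAST n. (\<delta> ^^ (n + 1)) a = 0)"


section \<open>One-parameter subgroups and invariants\<close>

text \<open>
  \<open>Aut(Z)\<close> is realised as the group of \<open>'k\<close>-algebra automorphisms of the coordinate ring; this
  is the setting in which \<open>exp (s \<delta>)\<close> is an element of it. Passing to automorphisms of the
  variety by pullback reverses products, which affects neither generated subgroups nor invariants.
\<close>

definition Aut :: "('i \<Rightarrow> 'k :: comm_ring_1) set \<Rightarrow>
    ((('i \<Rightarrow> 'k) \<Rightarrow> 'k) \<Rightarrow> (('i \<Rightarrow> 'k) \<Rightarrow> 'k)) monoid" where
  "Aut Z = BijGroup (coord_ring Z) \<lparr>carrier := {\<phi> \<in> Bij (coord_ring Z).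
     (\<forall>a\<in>coord_ring Z. \<forall>b\<in>coord_ring Z. \<phi> (a + b) = \<phi> a + \<phi> b) \<and>
     (\<forall>c. \<forall>a\<in>coord_ring Z. \<phi> (scale c a) = scale c (\<phi> a)) \<and>
     (\<forall>a\<in>coord_ring Z. \<forall>b\<in>coord_ring Z. \<phi> (a * b) = \<phi> a * \<phi> b)}\<rparr>"

text \<open>By local nilpotency the exponential series below has only finitely many nonzero terms.\<close>

definition lnd_exp :: "('i \<Rightarrow> 'k :: field_char_0) set \<Rightarrow> 'k \<Rightarrow>
    ((('i \<Rightarrow> 'k) \<Rightarrow> 'k) \<Rightarrow> (('i \<Rightarrow> 'k) \<Rightarrow> 'k)) \<Rightarrow>
    ((('i \<Rightarrow> 'k) \<Rightarrow> 'k) \<Rightarrow> (('i \<Rightarrow> 'k) \<Rightarrow> 'k))" where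
  "lnd_exp Z s \<delta> = (\<lambda>a\<in>coord_ring Z. \<Sum>n | (\<delta> ^^ n) a \<noteq> 0. scale (s ^ n / fact n) ((\<delta> ^^ n) a))"

definition N1 :: "('i \<Rightarrow> 'k :: comm_ring_1) set \<Rightarrow> (('i \<Rightarrow> 'k) \<Rightarrow> 'k) \<Rightarrow>
    ((('i \<Rightarrow> 'k) \<Rightarrow> 'k) \<Rightarrow> (('i \<Rightarrow> 'k) \<Rightarrow> 'k)) set" where
  "N1 Z f = {\<delta> \<in> LND Z. lnd_degree \<delta> f = 1} \<union> {\<lambda>a\<in>coord_ring Z. 0}"

definition G1 :: "('i \<Rightarrow> 'k :: field_char_0) set \<Rightarrow> (('i \<Rightarrow> 'k) \<Rightarrow> 'k) \<Rightarrow>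
    ((('i \<Rightarrow> 'k) \<Rightarrow> 'k) \<Rightarrow> (('i \<Rightarrow> 'k) \<Rightarrow> 'k)) set" where
  "G1 Z f = generate (Aut Z) (\<Union>\<delta>\<in>N1 Z f. {lnd_exp Z s \<delta> | s. True})"

definition invariants :: "('i \<Rightarrow> 'k :: comm_ring_1) set \<Rightarrow>
    ((('i \<Rightarrow> 'k) \<Rightarrow> 'k) \<Rightarrow> (('i \<Rightarrow> 'k) \<Rightarrow> 'k)) set \<Rightarrow> (('i \<Rightarrow> 'k) \<Rightarrow> 'k) set" where
  "invariants Z G = {a \<in> coord_ring Z. \<forall>\<phi>\<in>G. \<phi> a = a}"


section \<open>Suspensions\<close>

text \<open>
  The product of \<open>X\<close> with the affine space with coordinates \<open>y\<^sub>j\<close>, \<open>j :: 'm\<close>, lives in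
  \<open>'n + 'm \<Rightarrow> 'k\<close>; a point \<open>z\<close> of it consists of \<open>x = z \<circ> Inl\<close> and \<open>y = z \<circ> Inr\<close>.
\<close>

definition cylinder :: "('n \<Rightarrow> 'k) set \<Rightarrow> ('n + 'm \<Rightarrow> 'k) set" where
  "cylinder X = {z. z \<circ> Inl \<in> X}"

definition pullback :: "(('n \<Rightarrow> 'k) \<Rightarrow> 'k) \<Rightarrow> (('n + 'm \<Rightarrow> 'k) \<Rightarrow> 'k)" where
  "pullback a = (\<lambda>z. a (z \<circ> Inl))"

definition Susp :: "('n \<Rightarrow> 'k :: comm_ring_1) set \<Rightarrow> (('n \<Rightarrow> 'k) \<Rightarrow> 'k) \<Rightarrow> ('m :: finite \<Rightarrow> nat) \<Rightarrow>
    ('n + 'm \<Rightarrow> 'k) set" where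
  "Susp X f k = {z \<in> cylinder X. (\<Prod>j\<in>UNIV. z (Inr j) ^ k j) = f (z \<circ> Inl)}"

text \<open>
  The quotient map \<open>\<pi>\<close> from the coordinate ring of the cylinder to that of \<open>Susp X f k\<close> is the
  restriction \<open>on_var (Susp X f k)\<close>; the lemmas \<open>coord_ring_Susp\<close> and \<open>kernel_on_var_Susp\<close> show
  that it is onto, with kernel the ideal generated by \<open>susp_eq X f k\<close>.
\<close>

definition susp_eq :: "('n \<Rightarrow> 'k :: comm_ring_1) set \<Rightarrow> (('n \<Rightarrow> 'k) \<Rightarrow> 'k) \<Rightarrow> ('m :: finite \<Rightarrow> nat) \<Rightarrow>
    (('n + 'm \<Rightarrow> 'k) \<Rightarrow> 'k)" where
  "susp_eq X f k = on_var (cylinder X) (\<lambda>z. (\<Prod>j\<in>UNIV. z (Inr j) ^ k j) - f (z \<circ> Inl))"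


text \<open>
  Kernel of the restriction: modulo \<open>susp_eq\<close> every element is a sum of terms \<open>a(x) y\<^sup>\<alpha>\<close> with
  \<open>\<not> k \<le> \<alpha>\<close>; on a fibre of the suspension over \<open>f x \<noteq> 0\<close> these monomials are linearly
  independent, being distinct characters of the group \<open>y\<^sup>k = 1\<close>.
\<close>

lemma coord_ring_Susp:
  "on_var (Susp X f k) ` coord_ring (cylinder X) = coord_ring (Susp X f k)"
proof -
  have "on_var (Susp X f k) \<circ> on_var (cylinder X) = on_var (Susp X f k)"
    by (auto simp: on_var_def Susp_def fun_eq_iff)
  then show ?thesis unfolding coord_ring_def image_comp by (rule arg_cong)
qed

lemma poly_funs_sum:
  "(\<And>s. s \<in> S \<Longrightarrow> p s \<in> poly_funs) \<Longrightarrow> (\<lambda>x. \<Sum>s\<in>S. p s x) \<in> poly_funs"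
proof (induction S rule: infinite_finite_induct)
  case (insert s S)
  then show ?case using poly_funs.add[of "p s" "\<lambda>x. \<Sum>s\<in>S. p s x"] by (simp add: plus_fun_def)
qed (auto simp: poly_funs.const)

lemma poly_funs_power: "p \<in> poly_funs \<Longrightarrow> (\<lambda>x. p x ^ n) \<in> poly_funs"
proof (induction n)
  case (Suc n)
  then show ?case using poly_funs.mult[of p "\<lambda>x. p x ^ n"] by (simp add: times_fun_def)
qed (auto simp: poly_funs.const)

lemma poly_funs_prod:
  "(\<And>s. s \<in> S \<Longrightarrow> p s \<in> poly_funs) \<Longrightarrow> (\<lambda>x. \<Prod>s\<in>S. p s x) \<in> poly_funs"
proof (induction S rule: infinite_finite_induct)
  case (insert s S)
  then show ?case using poly_funs.mult[of "p s" "\<lambda>x. \<Prod>s\<in>S. p s x"] by (simp add: times_fun_def)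
qed (auto simp: poly_funs.const)

lemma poly_funs_minus: "p \<in> poly_funs \<Longrightarrow> (\<lambda>x. - p x) \<in> poly_funs"
  using poly_funs.mult[OF poly_funs.const[of "-1"], of p] by (simp add: times_fun_def)

lemma poly_funs_pullback:
  "p \<in> poly_funs \<Longrightarrow> (pullback p :: ('n + 'm \<Rightarrow> 'k :: comm_ring_1) \<Rightarrow> 'k) \<in> poly_funs"
proof (induction rule: poly_funs.induct)
  case (const c)
  then show ?case using poly_funs.const by (simp add: pullback_def)
next
  case (coord i)
  then show ?case using poly_funs.coord[of "Inl i"] by (simp add: pullback_def)
next
  case (add p q)
  then show ?case using poly_funs.add[OF add.IH] by (simp add: pullback_def plus_fun_def)
next
  case (mult p q)
  then show ?case using poly_funs.mult[OF mult.IH] by (simp add: pullback_def times_fun_def)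
qed

lemma coord_ring_const: "on_var Z (\<lambda>_. c) \<in> coord_ring Z"
  by (simp add: coord_ring_def poly_funs.const)

lemma coord_ring_zero: "0 \<in> coord_ring Z"
  using coord_ring_const[of Z 0] by (simp add: on_var_def zero_fun_def)

lemma coord_ring_add:
  assumes "a \<in> coord_ring Z" "b \<in> coord_ring Z"
  shows "a + b \<in> coord_ring Z"
proof -
  obtain p q where "p \<in> poly_funs" "q \<in> poly_funs" "a = on_var Z p" "b = on_var Z q"
    using assms by (auto simp: coord_ring_def)
  moreover from this have "a + b = on_var Z (p + q)" by (auto simp: on_var_def)
  ultimately show ?thesis by (auto simp: coord_ring_def intro: poly_funs.add)
qed

lemma coord_ring_mult:
  assumes "a \<in> coord_ring Z" "b \<in> coord_ring Z"
  shows "a * b \<in> coord_ring Z"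
proof -
  obtain p q where "p \<in> poly_funs" "q \<in> poly_funs" "a = on_var Z p" "b = on_var Z q"
    using assms by (auto simp: coord_ring_def)
  moreover from this have "a * b = on_var Z (p * q)" by (auto simp: on_var_def)
  ultimately show ?thesis by (auto simp: coord_ring_def intro: poly_funs.mult)
qed

lemma coord_ring_pullback:
  assumes "a \<in> coord_ring X"
  shows "(pullback a :: ('n + 'm \<Rightarrow> 'k :: comm_ring_1) \<Rightarrow> 'k) \<in> coord_ring (cylinder X)"
proof -
  obtain p where "p \<in> poly_funs" "a = on_var X p" using assms by (auto simp: coord_ring_def)
  moreover from this have "pullback a = on_var (cylinder X) (pullback p :: ('n + 'm \<Rightarrow> 'k) \<Rightarrow> 'k)"
    by (auto simp: on_var_def pullback_def cylinder_def)
  ultimately show ?thesis by (auto simp: coord_ring_def intro: poly_funs_pullback)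
qed

lemma coord_ring_susp_eq:
  fixes X :: "('n \<Rightarrow> 'k :: comm_ring_1) set" and k :: "'m :: finite \<Rightarrow> nat"
  assumes "f \<in> coord_ring X"
  shows "susp_eq X f k \<in> coord_ring (cylinder X)"
proof -
  obtain p where p: "p \<in> poly_funs" "f = on_var X p" using assms by (auto simp: coord_ring_def)
  define q :: "('n + 'm \<Rightarrow> 'k) \<Rightarrow> 'k" where "q = (\<lambda>z. \<Prod>j\<in>UNIV. z (Inr j) ^ k j) + (\<lambda>z. - pullback p z)"
  have "q \<in> poly_funs" unfolding q_def
    by (intro poly_funs.add poly_funs_prod poly_funs_power poly_funs.coord poly_funs_minus
        poly_funs_pullback p)
  moreover have "susp_eq X f k = on_var (cylinder X) q"
    using p by (auto simp: susp_eq_def on_var_def q_def pullback_def cylinder_def)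
  ultimately show ?thesis by (auto simp: coord_ring_def)
qed

lemma zariski_closed_cylinder:
  assumes "zariski_closed X"
  shows "zariski_closed (cylinder X :: ('n + 'm \<Rightarrow> 'k :: comm_ring_1) set)"
proof -
  obtain S where S: "S \<subseteq> poly_funs" "X = {x. \<forall>p\<in>S. p x = 0}"
    using assms by (auto simp: zariski_closed_def)
  have "pullback ` S \<subseteq> (poly_funs :: (('n + 'm \<Rightarrow> 'k) \<Rightarrow> 'k) set)"
    using S by (auto intro: poly_funs_pullback)
  moreover have "cylinder X = {z. \<forall>p\<in>pullback ` S. p (z :: 'n + 'm \<Rightarrow> 'k) = 0}"
    using S by (auto simp: cylinder_def pullback_def)
  ultimately show ?thesis unfolding zariski_closed_def by blast
qed

lemma zariski_closed_Susp:
  fixes X :: "('n \<Rightarrow> 'k :: comm_ring_1) set" and k :: "'m :: finite \<Rightarrow> nat"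
  assumes "zariski_closed X" "f \<in> coord_ring X"
  shows "zariski_closed (Susp X f k)"
proof -
  obtain S where S: "S \<subseteq> poly_funs" "cylinder X = {z :: 'n + 'm \<Rightarrow> 'k. \<forall>p\<in>S. p z = 0}"
    using zariski_closed_cylinder[OF assms(1)] unfolding zariski_closed_def by blast
  obtain q where q: "q \<in> poly_funs" "susp_eq X f k = on_var (cylinder X) q"
    using coord_ring_susp_eq[OF assms(2)] by (auto simp: coord_ring_def)
  have "q z = (\<Prod>j\<in>UNIV. z (Inr j) ^ k j) - f (z \<circ> Inl)" if "z \<in> cylinder X" for z
    using fun_cong[OF q(2), of z] that by (simp add: susp_eq_def on_var_def)
  then have "Susp X f k = {z \<in> cylinder X. q z = 0}"
    unfolding Susp_def by auto
  also have "\<dots> = {z. \<forall>p\<in>insert q S. p z = 0}"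
    using S(2) by auto
  finally show ?thesis unfolding zariski_closed_def
    using S(1) q(1) by (intro exI[of _ "insert q S"]) simp
qed

lemma card_roots_unity_eq:
  assumes "n > 0"
  shows "card {w :: 'k :: {alg_closed_field, field_char_0}. w ^ n = 1} = n"
proof -
  define p :: "'k poly" where "p = monom 1 n - 1"
  have p: "poly p w = w ^ n - 1" for w by (simp add: p_def poly_monom)
  have deg: "degree p = n"
  proof (rule antisym)
    show "degree p \<le> n" unfolding p_def by (intro degree_diff_le) (auto simp: degree_monom_le)
    show "n \<le> degree p" using assms by (intro le_degree) (simp add: p_def)
  qed
  have p0: "p \<noteq> 0" using deg assms by auto
  have dp: "poly (pderiv p) w = of_nat n * w ^ (n - 1)" for w
    by (simp add: p_def pderiv_diff pderiv_monom poly_monom)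
  have "rsquarefree p"
    unfolding rsquarefree_roots
  proof (intro allI notI)
    fix w assume w: "poly p w = 0 \<and> poly (pderiv p) w = 0"
    then have "w \<noteq> 0" using p[of w] assms by (auto simp: power_0_left)
    then show False using w dp[of w] assms by auto
  qed
  then have le1: "Polynomial.order w p \<le> 1" for w by (auto simp: rsquarefree_def dest: spec[of _ w])
  obtain A where A: "size A = degree p" "p = smult (lead_coeff p) (\<Prod>x\<in>#A. [:-x, 1:])"
    using alg_closed_imp_factorization[OF p0] by blast
  have "lead_coeff p \<noteq> 0" using p0 by simp
  have "proots p = proots (smult (lead_coeff p) (\<Prod>x\<in>#A. [:-x, 1:]))"
    by (rule arg_cong[OF A(2)])
  also have "\<dots> = proots (\<Prod>x\<in>#A. [:-x, 1:])"
    by (rule proots_smult[OF \<open>lead_coeff p \<noteq> 0\<close>])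
  also have "\<dots> = A"
  proof (induction A)
    case (add x A)
    have "(\<Prod>x\<in>#A. [:-x, 1:]) \<noteq> 0" by (auto simp: prod_mset_zero_iff)
    then show ?case using add by (simp add: proots_mult del: mult_pCons_left)
  qed simp
  finally have AA: "proots p = A" .
  have "size A = (\<Sum>x\<in>set_mset A. count A x)" by (simp add: size_multiset_overloaded_eq)
  also have "\<dots> = (\<Sum>x\<in>set_mset A. 1)"
  proof (rule sum.cong)
    fix x assume "x \<in># A"
    then have "1 \<le> count A x" by (simp only: count_greater_eq_one_iff)
    moreover have "count A x \<le> 1" using le1[of x] p0 by (simp add: AA[symmetric])
    ultimately show "count A x = 1" by (rule antisym[rotated])
  qed simp
  finally have "card (set_mset A) = n" using A deg by simp
  moreover have "set_mset A = {w. w ^ n = 1}" using p p0 by (simp add: AA[symmetric])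
  ultimately show ?thesis by simp
qed

lemma roots_unity_separate:
  assumes "n > 0" "a \<le> b"
    and eq: "\<And>w :: 'k :: {alg_closed_field, field_char_0}. w ^ n = 1 \<Longrightarrow> w ^ a = w ^ b"
  shows "n dvd b - a"
proof (rule ccontr)
  assume nd: "\<not> n dvd b - a"
  define r where "r = (b - a) mod n"
  have r: "0 < r" "r < n" using nd assms by (auto simp: r_def dvd_eq_mod_eq_0)
  have "{w :: 'k. w ^ n = 1} \<subseteq> {w. w ^ r = 1}"
  proof safe
    fix w :: 'k assume w: "w ^ n = 1"
    then have "w \<noteq> 0" using assms by (auto simp: power_0_left)
    have "w ^ a * w ^ (b - a) = w ^ b"
      using assms(2) by (simp flip: power_add)
    also have "\<dots> = w ^ a" using eq[OF w] by simp
    finally have "w ^ a * w ^ (b - a) = w ^ a" .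
    then have "w ^ (b - a) = 1" using \<open>w \<noteq> 0\<close> by simp
    moreover have "w ^ (b - a) = (w ^ n) ^ ((b - a) div n) * w ^ r"
      by (simp add: r_def flip: power_mult power_add)
    ultimately show "w ^ r = 1" using w by simp
  qed
  moreover have "finite {w :: 'k. w ^ r = 1}"
    using card_roots_unity_eq[where 'k='k, OF r(1)] r(1) by (metis card.infinite less_irrefl)
  ultimately have "n \<le> r"
    using card_mono card_roots_unity_eq[where 'k='k] r assms(1) by metis
  then show False using r by simp
qed

lemma characters_independent:
  fixes \<chi> :: "'s \<Rightarrow> 't \<Rightarrow> 'k :: field"
  assumes "finite S"
    and mult: "\<And>s t u. t \<in> T \<Longrightarrow> u \<in> T \<Longrightarrow> m t u \<in> T \<and> \<chi> s (m t u) = \<chi> s t * \<chi> s u"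
    and one: "e \<in> T" "\<And>s. \<chi> s e = 1"
    and sep: "\<And>s s'. s \<in> S \<Longrightarrow> s' \<in> S \<Longrightarrow> s \<noteq> s' \<Longrightarrow> \<exists>t\<in>T. \<chi> s t \<noteq> \<chi> s' t"
    and zero: "\<And>t. t \<in> T \<Longrightarrow> (\<Sum>s\<in>S. c s * \<chi> s t) = 0"
    and "s \<in> S"
  shows "c s = 0"
  using assms(1) sep zero \<open>s \<in> S\<close>
proof (induction S arbitrary: c s rule: finite_induct)
  case (insert s0 S)
  have S0: "c s' = 0" if s': "s' \<in> S" for s'
  proof -
    obtain u where u: "u \<in> T" "\<chi> s' u \<noteq> \<chi> s0 u"
      using insert.prems(1)[of s' s0] insert.hyps s' by auto
    have "(c s' * (\<chi> s' u - \<chi> s0 u)) = 0"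
    proof (rule insert.IH[where c = "\<lambda>s. c s * (\<chi> s u - \<chi> s0 u)"])
      fix t assume t: "t \<in> T"
      have "(\<Sum>s\<in>insert s0 S. c s * \<chi> s (m t u)) - \<chi> s0 u * (\<Sum>s\<in>insert s0 S. c s * \<chi> s t) = 0"
        using insert.prems(2)[OF t] insert.prems(2)[of "m t u"] mult[OF t u(1)] by simp
      also have "(\<Sum>s\<in>insert s0 S. c s * \<chi> s (m t u)) - \<chi> s0 u * (\<Sum>s\<in>insert s0 S. c s * \<chi> s t)
          = (\<Sum>s\<in>insert s0 S. c s * (\<chi> s u - \<chi> s0 u) * \<chi> s t)"
        unfolding sum_distrib_left sum_subtractf[symmetric] using t u mult
        by (intro sum.cong) (auto simp: algebra_simps)
      finally show "(\<Sum>s\<in>S. c s * (\<chi> s u - \<chi> s0 u) * \<chi> s t) = 0"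
        using insert.hyps by simp
    qed (use insert.prems s' in auto)
    then show ?thesis using u by simp
  qed
  moreover have "c s0 = 0"
    using insert.prems(2)[OF one(1)] insert.hyps S0 one(2) by simp
  ultimately show ?case using insert.prems by auto
qed simp

definition mono_fun :: "('m :: finite \<Rightarrow> nat) \<Rightarrow> ('m \<Rightarrow> 'k :: comm_ring_1) \<Rightarrow> 'k" where
  "mono_fun \<alpha> y = (\<Prod>j\<in>UNIV. y j ^ \<alpha> j)"

lemma mono_fun_times: "mono_fun \<alpha> (y * y') = mono_fun \<alpha> y * mono_fun \<alpha> y'"
  by (simp add: mono_fun_def power_mult_distrib prod.distrib)

lemma mono_fun_add: "mono_fun (\<lambda>j. \<alpha> j + \<beta> j) y = mono_fun \<alpha> y * mono_fun \<beta> y"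
  by (simp add: mono_fun_def power_add prod.distrib)

lemma mono_fun_one: "mono_fun \<alpha> 1 = 1"
  by (simp add: mono_fun_def)

lemma mono_fun_upd: "mono_fun \<alpha> (1(i := w)) = w ^ \<alpha> i"
proof -
  have "mono_fun \<alpha> (1(i := w)) = (\<Prod>j\<in>UNIV. if j = i then w ^ \<alpha> i else 1)"
    unfolding mono_fun_def by (intro prod.cong) auto
  then show ?thesis by simp
qed

lemma mono_fun_neq_0:
  fixes y :: "'m :: finite \<Rightarrow> 'k :: field"
  assumes "mono_fun k y \<noteq> 0" "\<And>j. k j > 0"
  shows "mono_fun \<alpha> y \<noteq> 0"
proof -
  have "y j \<noteq> 0" for j
    using assms by (auto simp: mono_fun_def)
  then show ?thesis by (simp add: mono_fun_def)
qed

lemma infinite_pow_eq_imp_eq: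
  fixes a b :: nat
  assumes "\<And>t :: 'k :: field_char_0. t \<noteq> 0 \<Longrightarrow> t ^ a = t ^ b"
  shows "a = b"
proof -
  have "(of_nat (2 ^ a) :: 'k) = of_nat (2 ^ b)" using assms[of 2] by simp
  then have "(2::nat) ^ a = 2 ^ b" by (simp only: of_nat_eq_iff)
  then show ?thesis by simp
qed

lemma mono_fun_separate:
  fixes k \<alpha> \<beta> :: "'m :: finite \<Rightarrow> nat"
  assumes k: "\<And>j. k j > 0" and \<alpha>: "\<not> k \<le> \<alpha>" and \<beta>: "\<not> k \<le> \<beta>"
    and eq: "\<And>y :: 'm \<Rightarrow> 'k :: {alg_closed_field, field_char_0}.
      mono_fun k y = 1 \<Longrightarrow> mono_fun \<alpha> y = mono_fun \<beta> y"
  shows "\<alpha> = \<beta>"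
proof -
  have cross: "k j * \<alpha> i + k i * \<beta> j = k j * \<beta> i + k i * \<alpha> j" if "i \<noteq> j" for i j
  proof (rule infinite_pow_eq_imp_eq[where 'k = 'k])
    fix t :: 'k assume t: "t \<noteq> 0"
    define y :: "'m \<Rightarrow> 'k" where "y = 1(i := t ^ k j) * 1(j := inverse t ^ k i)"
    have m: "mono_fun \<gamma> y = t ^ (k j * \<gamma> i) * inverse t ^ (k i * \<gamma> j)" for \<gamma>
      by (simp add: y_def mono_fun_times mono_fun_upd power_mult)
    have "mono_fun k y = 1" using t by (simp add: m power_inverse mult.commute)
    from eq[OF this] show "t ^ (k j * \<alpha> i + k i * \<beta> j) = t ^ (k j * \<beta> i + k i * \<alpha> j)"
      using t by (simp add: m power_inverse power_add field_simps)
  qed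
  have dvd: "k i dvd nat \<bar>int (\<alpha> i) - int (\<beta> i)\<bar>" for i
  proof -
    have e: "w ^ \<alpha> i = w ^ \<beta> i" if "w ^ k i = 1" for w :: 'k
      using eq[of "1(i := w)"] that by (simp add: mono_fun_upd)
    show ?thesis
    proof (cases "\<alpha> i \<le> \<beta> i")
      case True
      then have "nat \<bar>int (\<alpha> i) - int (\<beta> i)\<bar> = \<beta> i - \<alpha> i" by arith
      then show ?thesis using roots_unity_separate[OF k[of i] True e] by (simp only:)
    next
      case False
      then have "nat \<bar>int (\<alpha> i) - int (\<beta> i)\<bar> = \<alpha> i - \<beta> i" by arith
      moreover have "\<beta> i \<le> \<alpha> i" using False by simp
      ultimately show ?thesis using roots_unity_separate[OF k[of i] _ e[symmetric]] by (simp only:)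
    qed
  qed
  have "\<exists>q. int (\<alpha> i) - int (\<beta> i) = int (k i) * q" for i
  proof -
    have "int (k i) dvd \<bar>int (\<alpha> i) - int (\<beta> i)\<bar>"
      using dvd[of i] by (subst (asm) int_dvd_int_iff[symmetric]) simp
    then show ?thesis by (simp add: dvd_def[symmetric])
  qed
  then obtain q where q: "\<And>i. int (\<alpha> i) - int (\<beta> i) = int (k i) * q i" by metis
  have qeq: "q i = q j" for i j
  proof (cases "i = j")
    case False
    have "int (k j) * int (\<alpha> i) + int (k i) * int (\<beta> j) = int (k j) * int (\<beta> i) + int (k i) * int (\<alpha> j)"
      using arg_cong[OF cross[OF False], of int] by simp
    then have "int (k j) * (int (\<alpha> i) - int (\<beta> i)) = int (k i) * (int (\<alpha> j) - int (\<beta> j))"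
      by (simp add: algebra_simps)
    then have "int (k j) * int (k i) * q i = int (k j) * int (k i) * q j"
      unfolding q by (simp add: algebra_simps)
    then show ?thesis using k[of i] k[of j] by simp
  qed simp
  obtain i where i: "\<alpha> i < k i" using \<alpha> by (auto simp: le_fun_def not_le)
  obtain j where j: "\<beta> j < k j" using \<beta> by (auto simp: le_fun_def not_le)
  have "int (k i) * q i < int (k i) * 1" unfolding q[symmetric] using i by linarith
  then have 1: "q i < 1" using k[of i] by (simp only: mult_less_cancel_left_pos of_nat_0_less_iff)
  have "int (k j) * (-1) < int (k j) * q j" unfolding q[symmetric] using j by linarith
  then have 2: "-1 < q j" using k[of j] by (simp only: mult_less_cancel_left_pos of_nat_0_less_iff)
  have "q i' = 0" for i' using 1 2 qeq[of i j] qeq[of i i'] by simp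
  then show ?thesis using q by (auto simp: fun_eq_iff)
qed

lemma mono_fun_root:
  assumes "\<And>j. k j > 0"
  shows "\<exists>y :: 'm :: finite \<Rightarrow> 'k :: alg_closed_field. mono_fun k y = c"
  using nth_root_exists[OF assms, of undefined c] mono_fun_upd by metis

definition normal_form ::
    "('n \<Rightarrow> 'k :: comm_ring_1) set \<Rightarrow> (('n \<Rightarrow> 'k) \<Rightarrow> 'k) \<Rightarrow> ('m :: finite \<Rightarrow> nat) \<Rightarrow>
     (('n + 'm \<Rightarrow> 'k) \<Rightarrow> 'k) \<Rightarrow> bool" where
  "normal_form X f k h \<longleftrightarrow> (\<exists>g S a. g \<in> coord_ring (cylinder X) \<and> finite S \<and>
     (\<forall>\<alpha>\<in>S. \<not> k \<le> \<alpha> \<and> a \<alpha> \<in> coord_ring X) \<and>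
     (\<forall>z\<in>cylinder X. h z = susp_eq X f k z * g z + (\<Sum>\<alpha>\<in>S. a \<alpha> (z \<circ> Inl) * mono_fun \<alpha> (z \<circ> Inr))))"

lemma normal_form_cong:
  assumes "normal_form X f k h" "\<And>z. z \<in> cylinder X \<Longrightarrow> h z = h' z"
  shows "normal_form X f k h'"
proof -
  obtain g S a where "g \<in> coord_ring (cylinder X)" "finite S"
    "\<forall>\<alpha>\<in>S. \<not> k \<le> \<alpha> \<and> a \<alpha> \<in> coord_ring X"
    "\<forall>z\<in>cylinder X. h z = susp_eq X f k z * g z + (\<Sum>\<alpha>\<in>S. a \<alpha> (z \<circ> Inl) * mono_fun \<alpha> (z \<circ> Inr))"
    using assms(1) unfolding normal_form_def by blast
  then show ?thesis unfolding normal_form_def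
    by (intro exI[of _ g] exI[of _ S] exI[of _ a]) (simp add: assms(2)[symmetric])
qed

lemma normal_form_add:
  assumes "normal_form X f k h" "normal_form X f k h'"
  shows "normal_form X f k (h + h')"
proof -
  obtain g S a where 1: "g \<in> coord_ring (cylinder X)" "finite S"
    "\<forall>\<alpha>\<in>S. \<not> k \<le> \<alpha> \<and> a \<alpha> \<in> coord_ring X"
    "\<forall>z\<in>cylinder X. h z = susp_eq X f k z * g z + (\<Sum>\<alpha>\<in>S. a \<alpha> (z \<circ> Inl) * mono_fun \<alpha> (z \<circ> Inr))"
    using assms(1) unfolding normal_form_def by blast
  obtain g' S' a' where 2: "g' \<in> coord_ring (cylinder X)" "finite S'"
    "\<forall>\<alpha>\<in>S'. \<not> k \<le> \<alpha> \<and> a' \<alpha> \<in> coord_ring X"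
    "\<forall>z\<in>cylinder X. h' z = susp_eq X f k z * g' z + (\<Sum>\<alpha>\<in>S'. a' \<alpha> (z \<circ> Inl) * mono_fun \<alpha> (z \<circ> Inr))"
    using assms(2) unfolding normal_form_def by blast
  define b where "b \<alpha> = (if \<alpha> \<in> S then a \<alpha> else 0) + (if \<alpha> \<in> S' then a' \<alpha> else 0)" for \<alpha>
  have s: "(\<Sum>\<alpha>\<in>S \<union> S'. b \<alpha> (z \<circ> Inl) * mono_fun \<alpha> (z \<circ> Inr)) =
     (\<Sum>\<alpha>\<in>S. a \<alpha> (z \<circ> Inl) * mono_fun \<alpha> (z \<circ> Inr)) + (\<Sum>\<alpha>\<in>S'. a' \<alpha> (z \<circ> Inl) * mono_fun \<alpha> (z \<circ> Inr))" for z
  proof -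
    have "(\<Sum>\<alpha>\<in>S. a \<alpha> (z \<circ> Inl) * mono_fun \<alpha> (z \<circ> Inr)) =
        (\<Sum>\<alpha>\<in>S \<union> S'. (if \<alpha> \<in> S then a \<alpha> else 0) (z \<circ> Inl) * mono_fun \<alpha> (z \<circ> Inr))"
      by (rule sum.mono_neutral_cong_left) (use 1(2) 2(2) in auto)
    moreover have "(\<Sum>\<alpha>\<in>S'. a' \<alpha> (z \<circ> Inl) * mono_fun \<alpha> (z \<circ> Inr)) =
        (\<Sum>\<alpha>\<in>S \<union> S'. (if \<alpha> \<in> S' then a' \<alpha> else 0) (z \<circ> Inl) * mono_fun \<alpha> (z \<circ> Inr))"
      by (rule sum.mono_neutral_cong_left) (use 1(2) 2(2) in auto)
    ultimately show ?thesis
      unfolding b_def by (simp only: plus_fun_apply distrib_right sum.distrib)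
  qed
  show ?thesis unfolding normal_form_def
  proof (intro exI conjI ballI)
    show "g + g' \<in> coord_ring (cylinder X)" using 1 2 by (simp add: coord_ring_add)
    show "finite (S \<union> S')" using 1 2 by simp
    show "\<not> k \<le> \<alpha>" if "\<alpha> \<in> S \<union> S'" for \<alpha> using that 1 2 by auto
    show "b \<alpha> \<in> coord_ring X" if "\<alpha> \<in> S \<union> S'" for \<alpha>
      using 1 2 unfolding b_def by (intro coord_ring_add) (auto simp: coord_ring_zero)
    show "(h + h') z = susp_eq X f k z * (g + g') z +
        (\<Sum>\<alpha>\<in>S \<union> S'. b \<alpha> (z \<circ> Inl) * mono_fun \<alpha> (z \<circ> Inr))" if "z \<in> cylinder X" for z
      using 1(4) 2(4) that by (simp add: s distrib_left add_ac)
  qed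
qed

lemma normal_form_monomial:
  fixes k :: "'m :: finite \<Rightarrow> nat" and X :: "('n \<Rightarrow> 'k :: comm_ring_1) set"
  assumes k: "\<And>j. k j > 0" and f: "f \<in> coord_ring X" and a: "a \<in> coord_ring X"
  shows "normal_form X f k (\<lambda>z. a (z \<circ> Inl) * mono_fun \<alpha> (z \<circ> Inr))"
  using a
proof (induction "sum \<alpha> UNIV" arbitrary: a \<alpha> rule: less_induct)
  case less
  show ?case
  proof (cases "k \<le> \<alpha>")
    case False
    then show ?thesis unfolding normal_form_def
      by (intro exI[of _ 0] exI[of _ "{\<alpha>}"] exI[of _ "\<lambda>_. a"]) (simp add: less.prems coord_ring_zero)
  next
    case True
    define \<beta> where "\<beta> j = \<alpha> j - k j" for j
    have \<alpha>: "\<alpha> = (\<lambda>j. k j + \<beta> j)" using True by (auto simp: \<beta>_def le_fun_def)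
    have "\<beta> j < \<alpha> j" for j using k[of j] by (simp add: \<alpha>)
    then have "sum \<beta> UNIV < sum \<alpha> UNIV" by (intro sum_strict_mono) auto
    from less.hyps[OF this coord_ring_mult[OF less.prems f]]
    have nf: "normal_form X f k (\<lambda>z. (a * f) (z \<circ> Inl) * mono_fun \<beta> (z \<circ> Inr))" .
    define g :: "('n + 'm \<Rightarrow> 'k) \<Rightarrow> 'k" where
      "g = pullback a * on_var (cylinder X) (\<lambda>z. mono_fun \<beta> (z \<circ> Inr))"
    have "(\<lambda>z :: 'n + 'm \<Rightarrow> 'k. mono_fun \<beta> (z \<circ> Inr)) \<in> poly_funs"
      unfolding mono_fun_def o_def by (intro poly_funs_prod poly_funs_power poly_funs.coord)
    then have g: "g \<in> coord_ring (cylinder X)"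
      unfolding g_def by (intro coord_ring_mult coord_ring_pullback less.prems)
        (auto simp: coord_ring_def)
    have "normal_form X f k (susp_eq X f k * g)"
      unfolding normal_form_def
      by (intro exI[of _ g] exI[of _ "{}"]) (simp add: g)
    from normal_form_add[OF this nf]
    have *: "normal_form X f k (susp_eq X f k * g + (\<lambda>z. (a * f) (z \<circ> Inl) * mono_fun \<beta> (z \<circ> Inr)))" .
    have "(susp_eq X f k * g + (\<lambda>z. (a * f) (z \<circ> Inl) * mono_fun \<beta> (z \<circ> Inr))) z =
        a (z \<circ> Inl) * mono_fun \<alpha> (z \<circ> Inr)" if "z \<in> cylinder X" for z
    proof -
      have "mono_fun k (z \<circ> Inr) = susp_eq X f k z + f (z \<circ> Inl)"
        using that by (simp add: susp_eq_def on_var_def mono_fun_def)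
      moreover have "mono_fun \<alpha> (z \<circ> Inr) = mono_fun k (z \<circ> Inr) * mono_fun \<beta> (z \<circ> Inr)"
        unfolding \<alpha> by (rule mono_fun_add)
      ultimately show ?thesis using that
        by (simp add: g_def pullback_def on_var_def algebra_simps)
    qed
    with * show ?thesis by (rule normal_form_cong)
  qed
qed

lemma poly_funs_monomials:
  fixes p :: "('n + 'm :: finite \<Rightarrow> 'k :: comm_ring_1) \<Rightarrow> 'k"
  assumes "p \<in> poly_funs"
  shows "\<exists>I :: nat set. \<exists>a \<alpha>. finite I \<and> (\<forall>i\<in>I. a i \<in> poly_funs) \<and>
    (\<forall>z. p z = (\<Sum>i\<in>I. a i (z \<circ> Inl) * mono_fun (\<alpha> i) (z \<circ> Inr)))"
  using assms
proof (induction rule: poly_funs.induct)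
  case (const c)
  show ?case
    by (intro exI[of _ "{0}"] exI[of _ "\<lambda>_ _. c"] exI[of _ "\<lambda>_ _. 0"])
      (auto simp: poly_funs.const mono_fun_def)
next
  case (coord i)
  show ?case
  proof (cases i)
    case (Inl i')
    then show ?thesis
      by (intro exI[of _ "{0}"] exI[of _ "\<lambda>_ x. x i'"] exI[of _ "\<lambda>_ _. 0"])
        (auto simp: poly_funs.coord mono_fun_def)
  next
    case (Inr j)
    have "(\<Prod>j'\<in>UNIV. y j' ^ (if j' = j then 1 else 0)) = (\<Prod>j'\<in>UNIV. if j' = j then y j else 1)"
      for y :: "'m \<Rightarrow> 'k"
      by (intro prod.cong) auto
    then have "mono_fun (\<lambda>j'. if j' = j then 1 else 0) y = y j" for y :: "'m \<Rightarrow> 'k"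
      by (simp add: mono_fun_def)
    then show ?thesis unfolding Inr
      by (intro exI[of _ "{0}"] exI[of _ "\<lambda>_ _. 1"] exI[of _ "\<lambda>_ j'. if j' = j then 1 else 0"])
        (simp add: poly_funs.const)
  qed
next
  case (add p q)
  obtain I :: "nat set" and a \<alpha> where I:
    "finite I" "\<forall>i\<in>I. a i \<in> poly_funs"
    "\<forall>z. p z = (\<Sum>i\<in>I. a i (z \<circ> Inl) * mono_fun (\<alpha> i) (z \<circ> Inr))"
    using add.IH(1) by blast
  obtain J :: "nat set" and b \<beta> where J:
    "finite J" "\<forall>i\<in>J. b i \<in> poly_funs"
    "\<forall>z. q z = (\<Sum>i\<in>J. b i (z \<circ> Inl) * mono_fun (\<beta> i) (z \<circ> Inr))"
    using add.IH(2) by blast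
  note IJ = I J
  define L where "L = (\<lambda>i. 2 * i) ` I \<union> (\<lambda>i. 2 * i + 1) ` J"
  define c where "c i = (if even i then a (i div 2) else b (i div 2))" for i
  define \<gamma> where "\<gamma> i = (if even i then \<alpha> (i div 2) else \<beta> (i div 2))" for i
  have "(\<Sum>i\<in>L. c i (z \<circ> Inl) * mono_fun (\<gamma> i) (z \<circ> Inr)) = p z + q z" for z
  proof -
    have "(\<Sum>i\<in>L. c i (z \<circ> Inl) * mono_fun (\<gamma> i) (z \<circ> Inr)) =
       (\<Sum>i\<in>(\<lambda>i. 2 * i) ` I. c i (z \<circ> Inl) * mono_fun (\<gamma> i) (z \<circ> Inr)) +
       (\<Sum>i\<in>(\<lambda>i. 2 * i + 1) ` J. c i (z \<circ> Inl) * mono_fun (\<gamma> i) (z \<circ> Inr))"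
      unfolding L_def
      by (rule sum.union_disjoint) (use IJ in \<open>auto, presburger\<close>)
    also have "\<dots> = p z + q z"
      by (subst (1 2) sum.reindex) (auto simp: inj_on_def c_def \<gamma>_def IJ(3,6))
    finally show ?thesis .
  qed
  moreover have "finite L" "\<forall>i\<in>L. c i \<in> poly_funs" using IJ by (auto simp: L_def c_def)
  ultimately show ?case
    by (intro exI[of _ L] exI[of _ c] exI[of _ \<gamma>]) (simp only: plus_fun_apply simp_thms)
next
  case (mult p q)
  obtain I :: "nat set" and a \<alpha> where I:
    "finite I" "\<forall>i\<in>I. a i \<in> poly_funs"
    "\<forall>z. p z = (\<Sum>i\<in>I. a i (z \<circ> Inl) * mono_fun (\<alpha> i) (z \<circ> Inr))"
    using mult.IH(1) by blast
  obtain J :: "nat set" and b \<beta> where J: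
    "finite J" "\<forall>i\<in>J. b i \<in> poly_funs"
    "\<forall>z. q z = (\<Sum>i\<in>J. b i (z \<circ> Inl) * mono_fun (\<beta> i) (z \<circ> Inr))"
    using mult.IH(2) by blast
  note IJ = I J
  obtain e :: "nat \<times> nat \<Rightarrow> nat" where e: "bij e"
    using bij_prod_encode by blast
  define d where "d = inv_into UNIV e"
  have d: "d (e x) = x" for x using e by (simp add: d_def bij_is_inj)
  define L where "L = e ` (I \<times> J)"
  define c where "c i = a (fst (d i)) * b (snd (d i))" for i
  define \<gamma> where "\<gamma> i = (\<lambda>j. \<alpha> (fst (d i)) j + \<beta> (snd (d i)) j)" for i
  have "(\<Sum>i\<in>L. c i (z \<circ> Inl) * mono_fun (\<gamma> i) (z \<circ> Inr)) = p z * q z" for z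
  proof -
    have "(\<Sum>i\<in>L. c i (z \<circ> Inl) * mono_fun (\<gamma> i) (z \<circ> Inr)) =
      (\<Sum>x\<in>I \<times> J. c (e x) (z \<circ> Inl) * mono_fun (\<gamma> (e x)) (z \<circ> Inr))"
      unfolding L_def by (subst sum.reindex) (auto intro: inj_on_subset[OF bij_is_inj[OF e]])
    also have "\<dots> = (\<Sum>(i,j)\<in>I \<times> J. (a i (z \<circ> Inl) * mono_fun (\<alpha> i) (z \<circ> Inr)) *
        (b j (z \<circ> Inl) * mono_fun (\<beta> j) (z \<circ> Inr)))"
      by (intro sum.cong) (auto simp: c_def \<gamma>_def d mono_fun_add algebra_simps)
    also have "\<dots> = p z * q z"
      unfolding sum.cartesian_product[symmetric] IJ(3,6)[rule_format] sum_product ..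
    finally show ?thesis .
  qed
  moreover have "finite L" "\<forall>i\<in>L. c i \<in> poly_funs"
    using IJ by (auto simp: L_def c_def d intro: poly_funs.mult)
  ultimately show ?case
    by (intro exI[of _ L] exI[of _ c] exI[of _ \<gamma>]) (simp only: times_fun_apply simp_thms)
qed

lemma normal_form_sum:
  assumes "finite I" "\<And>i. i \<in> I \<Longrightarrow> normal_form X f k (h i)"
  shows "normal_form X f k (\<lambda>z. \<Sum>i\<in>I. h i z)"
  using assms
proof (induction I rule: finite_induct)
  case empty
  show ?case unfolding normal_form_def
    by (intro exI[of _ 0] exI[of _ "{}"]) (simp add: coord_ring_zero)
next
  case (insert i I)
  then show ?case using normal_form_add[of X f k "h i" "\<lambda>z. \<Sum>i\<in>I. h i z"]
    by (simp add: plus_fun_def)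
qed

lemma normal_form_exists:
  fixes k :: "'m :: finite \<Rightarrow> nat" and X :: "('n \<Rightarrow> 'k :: comm_ring_1) set"
  assumes k: "\<And>j. k j > 0" and f: "f \<in> coord_ring X" and h: "h \<in> coord_ring (cylinder X)"
  shows "normal_form X f k h"
proof -
  obtain p where p: "p \<in> poly_funs" "h = on_var (cylinder X) p"
    using h by (auto simp: coord_ring_def)
  obtain I :: "nat set" and a \<alpha> where I: "finite I" "\<forall>i\<in>I. a i \<in> poly_funs"
    "\<forall>z. p z = (\<Sum>i\<in>I. a i (z \<circ> Inl) * mono_fun (\<alpha> i) (z \<circ> Inr))"
    using poly_funs_monomials[OF p(1)] by blast
  have "normal_form X f k (\<lambda>z. \<Sum>i\<in>I. on_var X (a i) (z \<circ> Inl) * mono_fun (\<alpha> i) (z \<circ> Inr))"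
    by (intro normal_form_sum I normal_form_monomial k f) (use I(2) in \<open>auto simp: coord_ring_def\<close>)
  moreover have "h z = (\<Sum>i\<in>I. on_var X (a i) (z \<circ> Inl) * mono_fun (\<alpha> i) (z \<circ> Inr))"
    if "z \<in> cylinder X" for z
    using that by (simp add: p on_var_def I(3)) (simp add: cylinder_def)
  ultimately show ?thesis by (rule normal_form_cong[OF _ sym])
qed

lemma coord_ring_integral:
  fixes X :: "('n \<Rightarrow> 'k :: idom) set"
  assumes "zariski_irreducible X" "a \<in> coord_ring X" "b \<in> coord_ring X" "a * b = 0"
  shows "a = 0 \<or> b = 0"
proof -
  obtain p q where pq: "p \<in> poly_funs" "q \<in> poly_funs" "a = on_var X p" "b = on_var X q"
    using assms by (auto simp: coord_ring_def)
  have "zariski_closed {x. p x = 0}" if "p \<in> poly_funs" for p :: "('n \<Rightarrow> 'k) \<Rightarrow> 'k"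
    unfolding zariski_closed_def using that by (intro exI[of _ "{p}"]) auto
  moreover have "a x = 0 \<or> b x = 0" for x
    using fun_cong[OF assms(4), of x] by simp
  then have "X \<subseteq> {x. p x = 0} \<union> {x. q x = 0}"
    using pq by (auto simp: on_var_def split: if_splits) metis
  ultimately have "X \<subseteq> {x. p x = 0} \<or> X \<subseteq> {x. q x = 0}"
    using assms(1) pq(1,2) unfolding zariski_irreducible_def by blast
  then show ?thesis using pq by (auto simp: on_var_def fun_eq_iff)
qed

theorem kernel_on_var_Susp:
  fixes X :: "('n \<Rightarrow> 'k :: {alg_closed_field, field_char_0}) set" and k :: "'m :: finite \<Rightarrow> nat"
  assumes "zariski_irreducible X" and f: "f \<in> coord_ring X - scalars X" and k: "\<And>j. k j > 0"
  shows "{h \<in> coord_ring (cylinder X). on_var (Susp X f k) h = 0} =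
         {susp_eq X f k * g | g. g \<in> coord_ring (cylinder X)}"
proof safe
  fix g :: "('n + 'm \<Rightarrow> 'k) \<Rightarrow> 'k"
  assume g: "g \<in> coord_ring (cylinder X)"
  show "susp_eq X f k * g \<in> coord_ring (cylinder X)"
    using g f by (simp add: coord_ring_mult coord_ring_susp_eq)
  show "on_var (Susp X f k) (susp_eq X f k * g) = 0"
    by (auto simp: on_var_def susp_eq_def Susp_def)
next
  fix h :: "('n + 'm \<Rightarrow> 'k) \<Rightarrow> 'k"
  assume h: "h \<in> coord_ring (cylinder X)" and h0: "on_var (Susp X f k) h = 0"
  have "normal_form X f k h" by (rule normal_form_exists[OF k _ h]) (use f in simp)
  then obtain g S a where nf: "g \<in> coord_ring (cylinder X)" "finite S"
    "\<forall>\<alpha>\<in>S. \<not> k \<le> \<alpha> \<and> a \<alpha> \<in> coord_ring X"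
    "\<forall>z\<in>cylinder X.
       h z = susp_eq X f k z * g z + (\<Sum>\<alpha>\<in>S. a \<alpha> (z \<circ> Inl) * mono_fun \<alpha> (z \<circ> Inr))"
    unfolding normal_form_def by blast
  have "f \<noteq> 0"
  proof
    assume "f = 0"
    then have "f = on_var X (\<lambda>_. 0)" by (simp add: on_var_def zero_fun_def)
    then show False using f by (auto simp: scalars_def)
  qed
  have "a \<alpha> = 0" if \<alpha>: "\<alpha> \<in> S" for \<alpha>
  proof -
    have "f x = 0 \<or> a \<alpha> x = 0" for x
    proof (cases "x \<in> X \<and> f x \<noteq> 0")
      case False
      then show ?thesis using f by (auto simp: coord_ring_def on_var_def)
    next
      case True
      have "\<exists>y :: 'm \<Rightarrow> 'k. mono_fun k y = f x" by (rule mono_fun_root[OF k])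
      then obtain y :: "'m \<Rightarrow> 'k" where y: "mono_fun k y = f x" ..
      have "a \<alpha> x * mono_fun \<alpha> y = 0"
      proof (rule characters_independent[where S = S and T = "{t. mono_fun k t = 1}" and m = "(*)"
            and e = 1 and \<chi> = mono_fun and c = "\<lambda>\<alpha>. a \<alpha> x * mono_fun \<alpha> y"])
        fix t :: "'m \<Rightarrow> 'k" assume t: "t \<in> {t. mono_fun k t = 1}"
        define z where "z = case_sum x (y * t)"
        have z: "z \<circ> Inl = x" "z \<circ> Inr = y * t" by (auto simp: z_def fun_eq_iff)
        have "(\<Prod>j\<in>UNIV. z (Inr j) ^ k j) = mono_fun k (z \<circ> Inr)" by (simp add: mono_fun_def)
        also have "\<dots> = f x" using y t by (simp add: z mono_fun_times)
        finally have zS: "z \<in> Susp X f k" using True by (simp add: Susp_def cylinder_def z)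
        then have "susp_eq X f k z = 0" by (simp add: susp_eq_def Susp_def on_var_def)
        moreover have "h z = 0" using fun_cong[OF h0, of z] zS by (simp add: on_var_def)
        moreover have "z \<in> cylinder X" using zS by (simp add: Susp_def)
        ultimately have "(\<Sum>\<alpha>\<in>S. a \<alpha> (z \<circ> Inl) * mono_fun \<alpha> (z \<circ> Inr)) = 0" using nf(4) by simp
        then show "(\<Sum>\<alpha>\<in>S. a \<alpha> x * mono_fun \<alpha> y * mono_fun \<alpha> t) = 0"
          by (simp add: z mono_fun_times mult.assoc)
      next
        fix s s' assume "s \<in> S" "s' \<in> S" "s \<noteq> s'"
        then show "\<exists>t\<in>{t :: 'm \<Rightarrow> 'k. mono_fun k t = 1}. mono_fun s t \<noteq> mono_fun s' t"
          using mono_fun_separate[where k = k and \<alpha> = s and \<beta> = s' and 'k = 'k, OF k] nf(3) by blast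
      qed (use nf(2) \<alpha> in \<open>auto simp: mono_fun_times mono_fun_one\<close>)
      moreover have "mono_fun \<alpha> y \<noteq> 0" by (rule mono_fun_neq_0[where k = k, OF _ k]) (simp add: y True)
      ultimately show ?thesis by simp
    qed
    then have "f * a \<alpha> = 0" by (auto simp: fun_eq_iff)
    then show ?thesis
      using coord_ring_integral[OF assms(1)] f nf(3) \<alpha> \<open>f \<noteq> 0\<close> by blast
  qed
  then have "h z = (susp_eq X f k * g) z" if "z \<in> cylinder X" for z
    using nf(4) that by simp
  moreover have "h z = 0" "susp_eq X f k z = 0" if "z \<notin> cylinder X" for z
    using that h by (auto simp: coord_ring_def on_var_def susp_eq_def)
  ultimately have "h z = (susp_eq X f k * g) z" for z by (cases "z \<in> cylinder X") simp_all
  then have "h = susp_eq X f k * g" by (rule ext)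
  then show "\<exists>g. h = susp_eq X f k * g \<and> g \<in> coord_ring (cylinder X)" using nf(1) by blast
qed

end

theory Submission
  imports Defs
begin

text \<open>
  Write \<open>\<K>[Y] = \<K>[X][y\<^sub>1,\<dots>,y\<^sub>m]/(y\<^sup>k - f)\<close>. A derivation \<open>\<delta>\<close> of \<open>\<K>[X]\<close> extends to \<open>\<K>[X][y]\<close> coefficientwise, and
  \<open>\<partial>\<^sub>i(y\<^sup>k) \<delta> + \<delta>(f) \<partial>\<^sub>i\<close> kills \<open>y\<^sup>k - f\<close>; so it induces a derivation \<open>\<delta>\<^sub>i\<close> of \<open>\<K>[Y]\<close>, with
  \<open>y\<^sub>i \<mapsto> \<delta>(f)\<close>, \<open>y\<^sub>j \<mapsto> 0\<close> for \<open>j \<noteq> i\<close>, and \<open>a \<mapsto> \<partial>\<^sub>i(y\<^sup>k) \<delta>(a)\<close> for \<open>a \<in> \<K>[X]\<close>. It is locally nilpotent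
  for every locally nilpotent \<open>\<delta>\<close> if \<open>k\<^sub>i = 1\<close>, and for those with \<open>\<delta>\<^sup>2(f) = 0\<close> if \<open>k\<^sub>i > 1\<close>
  (\<open>susp_derivation_nilpotent\<close>).

  Every \<open>h \<in> \<K>[Y]\<close> has a normal form \<open>\<Sum> a\<^sub>\<alpha> y\<^sup>\<alpha>\<close> with no \<open>\<alpha> \<ge> k\<close>, which is its decomposition into
  weight vectors for the group \<open>y\<^sup>k = 1\<close>. The derivation \<open>\<delta>\<^sub>i\<close> is homogeneous, so that \<open>\<delta>\<^sub>i(h) = 0\<close> holds
  componentwise; multiplied by \<open>y\<^sub>i\<close> it says \<open>k\<^sub>i \<delta>(a\<^sub>\<alpha>) f + \<alpha>\<^sub>i a\<^sub>\<alpha> \<delta>(f) = 0\<close> (\<open>kernel_componentwise\<close>).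
  If \<open>\<alpha>\<^sub>i > 0\<close> and \<open>\<delta>(f) \<noteq> 0\<close>, this forces \<open>a\<^sub>\<alpha> = 0\<close>: restricted to an orbit of \<open>exp(t\<delta>)\<close> the left-hand side
  is, up to a factor, the derivative of \<open>a\<^sub>\<alpha>\<close> to the \<open>k\<^sub>i\<close> times \<open>f\<close> to the \<open>\<alpha>\<^sub>i\<close>, and a product of
  nonzero polynomials in one variable is constant only if its factors are (\<open>positive_weight_vanishes\<close>).
  Hence, as soon as one \<open>\<delta>\<close> with \<open>\<delta>(f) \<noteq> 0\<close> lifts in every direction \<open>i\<close>, the elements of \<open>ML(Y)\<close> come
  from \<open>\<K>[X]\<close>. For \<open>\<alpha> = 0\<close> the relation is \<open>\<delta>(a\<^sub>0) = 0\<close>, for every \<open>\<delta>\<close> that lifts in some direction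
  (\<open>makar_limanov_Susp\<close>): for all locally nilpotent \<open>\<delta>\<close> if some \<open>k\<^sub>i = 1\<close>, and otherwise for those of
  degree one at \<open>f\<close>, whose exponentials generate the group in the third claim.
\<close>


section \<open>Derivations of a coordinate ring\<close>

type_synonym ('i, 'k) operator = "(('i \<Rightarrow> 'k) \<Rightarrow> 'k) \<Rightarrow> (('i \<Rightarrow> 'k) \<Rightarrow> 'k)"

definition derivations :: "('i \<Rightarrow> 'k :: comm_ring_1) set \<Rightarrow> ('i, 'k) operator set" where
  "derivations Z = {D \<in> coord_ring Z \<rightarrow> coord_ring Z.
     (\<forall>a\<in>coord_ring Z. \<forall>b\<in>coord_ring Z. D (a + b) = D a + D b) \<and>
     (\<forall>c. \<forall>a\<in>coord_ring Z. D (scale c a) = scale c (D a)) \<and>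
     (\<forall>a\<in>coord_ring Z. \<forall>b\<in>coord_ring Z. D (a * b) = D a * b + a * D b)}"

lemma LND_iff:
  fixes D :: "('i, 'k :: comm_ring_1) operator"
  shows "D \<in> LND Z \<longleftrightarrow> D \<in> extensional (coord_ring Z) \<and> D \<in> derivations Z \<and>
    (\<forall>a\<in>coord_ring Z. \<exists>n. (D ^^ n) a = 0)"
  by (auto simp: LND_def derivations_def PiE_def)

lemma derivation_closed: "D \<in> derivations Z \<Longrightarrow> a \<in> coord_ring Z \<Longrightarrow> D a \<in> coord_ring Z"
  by (auto simp: derivations_def)

lemma derivation_add: "D \<in> derivations Z \<Longrightarrow> a \<in> coord_ring Z \<Longrightarrow> b \<in> coord_ring Z \<Longrightarrow>
    D (a + b) = D a + D b"
  by (simp add: derivations_def)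

lemma derivation_scale: "D \<in> derivations Z \<Longrightarrow> a \<in> coord_ring Z \<Longrightarrow> D (scale c a) = scale c (D a)"
  by (simp add: derivations_def)

lemma derivation_mult: "D \<in> derivations Z \<Longrightarrow> a \<in> coord_ring Z \<Longrightarrow> b \<in> coord_ring Z \<Longrightarrow>
    D (a * b) = D a * b + a * D b"
  by (simp add: derivations_def)

lemma LND_derivation: "D \<in> LND Z \<Longrightarrow> D \<in> derivations Z"
  by (simp add: LND_iff)

lemma LND_nilpotent:
  fixes D :: "('i, 'k :: comm_ring_1) operator"
  shows "D \<in> LND Z \<Longrightarrow> a \<in> coord_ring Z \<Longrightarrow> \<exists>n. (D ^^ n) a = 0"
  by (simp add: LND_iff)

lemma coord_ring_outside: "a \<in> coord_ring Z \<Longrightarrow> x \<notin> Z \<Longrightarrow> a x = 0"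
  by (auto simp: coord_ring_def on_var_def)

lemma coord_ring_scale:
  assumes "a \<in> coord_ring Z" shows "scale c a \<in> coord_ring Z"
proof -
  have "scale c a = on_var Z (\<lambda>_. c) * a"
    using coord_ring_outside[OF assms] by (auto simp: scale_def on_var_def fun_eq_iff)
  then show ?thesis using assms by (simp add: coord_ring_mult coord_ring_const)
qed

lemma scale_apply: "scale c a x = c * a x"
  by (simp add: scale_def)

lemma scale_zero: "scale c 0 = 0"
  by (simp add: scale_def fun_eq_iff)

lemma coord_ring_sum:
  "(\<And>s. s \<in> S \<Longrightarrow> F s \<in> coord_ring Z) \<Longrightarrow> sum F S \<in> coord_ring Z"
  by (induction S rule: infinite_finite_induct) (auto simp: coord_ring_zero coord_ring_add)

lemma derivation_zero:
  fixes D :: "('i, 'k :: comm_ring_1) operator"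
  assumes "D \<in> derivations Z" shows "D 0 = 0"
proof -
  have "D (scale 0 0) = scale 0 (D 0)" by (rule derivation_scale[OF assms coord_ring_zero])
  moreover have "scale 0 a = 0" for a :: "('i \<Rightarrow> 'k) \<Rightarrow> 'k" by (simp add: scale_def fun_eq_iff)
  ultimately show ?thesis by simp
qed

lemma derivation_sum:
  fixes D :: "('i, 'k :: comm_ring_1) operator"
  assumes "D \<in> derivations Z" "\<And>s. s \<in> S \<Longrightarrow> F s \<in> coord_ring Z"
  shows "D (sum F S) = (\<Sum>s\<in>S. D (F s))"
  using assms(2)
  by (induction S rule: infinite_finite_induct)
    (simp_all add: derivation_zero[OF assms(1)] derivation_add[OF assms(1)] coord_ring_sum)

lemma derivation_const:
  fixes D :: "('i, 'k :: comm_ring_1) operator"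
  assumes "D \<in> derivations Z" shows "D (on_var Z (\<lambda>_. c)) = 0"
proof -
  define e where "e = on_var Z (\<lambda>_. 1 :: 'k)"
  have e: "e \<in> coord_ring Z" by (simp add: e_def coord_ring_const)
  have De: "D e \<in> coord_ring Z" by (rule derivation_closed[OF assms e])
  have "e * D e = D e" "e * e = e"
    using coord_ring_outside[OF De] by (auto simp: e_def on_var_def fun_eq_iff)
  then have "D e = 0" using derivation_mult[OF assms e e] by (simp add: mult.commute)
  moreover have "on_var Z (\<lambda>_. c) = scale c e" by (auto simp: e_def on_var_def scale_def)
  ultimately show ?thesis using derivation_scale[OF assms e] by (simp add: scale_zero)
qed

lemma derivation_iterate_closed:
  fixes D :: "('i, 'k :: comm_ring_1) operator"
  assumes "D \<in> derivations Z" "a \<in> coord_ring Z" shows "(D ^^ n) a \<in> coord_ring Z"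
proof (induction n)
  case (Suc n)
  then show ?case using derivation_closed[OF assms(1)] by (simp only: funpow.simps o_apply)
qed (use assms in simp)

lemma derivation_iterate_zero:
  fixes D :: "('i, 'k :: comm_ring_1) operator"
  assumes "D \<in> derivations Z" shows "(D ^^ n) 0 = 0"
  by (induction n) (simp_all only: funpow.simps o_apply id_apply derivation_zero[OF assms])

lemma derivation_iterate_add:
  fixes D :: "('i, 'k :: comm_ring_1) operator" and a b :: "('i \<Rightarrow> 'k) \<Rightarrow> 'k"
  assumes "D \<in> derivations Z" "a \<in> coord_ring Z" "b \<in> coord_ring Z"
  shows "(D ^^ n) (a + b) = (D ^^ n) a + (D ^^ n) b"
proof (induction n)
  case (Suc n)
  have "(D ^^ n) a \<in> coord_ring Z" "(D ^^ n) b \<in> coord_ring Z"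
    using assms by (auto intro: derivation_iterate_closed)
  then have "D ((D ^^ n) (a + b)) = D ((D ^^ n) a) + D ((D ^^ n) b)"
    unfolding Suc.IH by (rule derivation_add[OF assms(1)])
  then show "(D ^^ Suc n) (a + b) = (D ^^ Suc n) a + (D ^^ Suc n) b"
    by (simp only: funpow.simps o_apply)
qed simp

lemma derivation_iterate_scale:
  fixes D :: "('i, 'k :: comm_ring_1) operator"
  assumes "D \<in> derivations Z" "a \<in> coord_ring Z"
  shows "(D ^^ n) (scale c a) = scale c ((D ^^ n) a)"
proof (induction n)
  case (Suc n)
  have "D ((D ^^ n) (scale c a)) = scale c (D ((D ^^ n) a))"
    unfolding Suc.IH by (rule derivation_scale[OF assms(1) derivation_iterate_closed[OF assms]])
  then show ?case by (simp only: funpow.simps o_apply)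
qed simp

lemma derivation_iterate_mono:
  fixes D :: "('i, 'k :: comm_ring_1) operator"
  assumes "D \<in> derivations Z" "(D ^^ n) a = 0" "n \<le> m"
  shows "(D ^^ m) a = 0"
proof -
  have "(D ^^ m) a = (D ^^ (m - n)) ((D ^^ n) a)"
    using assms(3) by (simp flip: comp_apply[of "D ^^ (m - n)"] funpow_add)
  then show ?thesis using assms by (simp add: derivation_iterate_zero)
qed

lemma nilpotent_add:
  fixes D :: "('i, 'k :: comm_ring_1) operator" and a b :: "('i \<Rightarrow> 'k) \<Rightarrow> 'k"
  assumes D: "D \<in> derivations Z" and ab: "a \<in> coord_ring Z" "b \<in> coord_ring Z"
    and "\<exists>n. (D ^^ n) a = 0" "\<exists>n. (D ^^ n) b = 0"
  shows "\<exists>n. (D ^^ n) (a + b) = 0"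
proof -
  obtain n m where "(D ^^ n) a = 0" "(D ^^ m) b = 0" using assms by blast
  then have "(D ^^ (n + m)) a = 0" "(D ^^ (n + m)) b = 0"
    by (auto intro: derivation_iterate_mono[OF D])
  then show ?thesis using derivation_iterate_add[OF D ab, of "n + m"] by auto
qed

text \<open>
  By the Leibniz rule each application of \<open>D\<close> lowers the order of one of the two factors.
\<close>

lemma nilpotent_mult:
  fixes D :: "('i, 'k :: comm_ring_1) operator" and a b :: "('i \<Rightarrow> 'k) \<Rightarrow> 'k"
  assumes D: "D \<in> derivations Z" and ab: "a \<in> coord_ring Z" "b \<in> coord_ring Z"
    and "\<exists>n. (D ^^ n) a = 0" "\<exists>n. (D ^^ n) b = 0"
  shows "\<exists>n. (D ^^ n) (a * b) = 0"
proof -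
  have "(D ^^ (n + m)) (a * b) = 0"
    if "(D ^^ n) a = 0" "(D ^^ m) b = 0" "a \<in> coord_ring Z" "b \<in> coord_ring Z"
    for n m and a b :: "('i \<Rightarrow> 'k) \<Rightarrow> 'k"
    using that
  proof (induction "n + m" arbitrary: n m a b)
    case 0
    then show ?case by simp
  next
    case (Suc N)
    show ?case
    proof (cases "n = 0 \<or> m = 0")
      case True
      then have "a * b = 0" using Suc.prems by auto
      then show ?thesis by (simp only: derivation_iterate_zero[OF D])
    next
      case False
      then obtain n' m' where nm: "n = Suc n'" "m = Suc m'" by (metis not0_implies_Suc)
      have closed: "D a \<in> coord_ring Z" "D b \<in> coord_ring Z" using derivation_closed[OF D] Suc.prems by auto
      have "(D ^^ (n' + m)) (D a * b) = 0"
        by (rule Suc.hyps(1)) (use Suc.hyps(2) Suc.prems nm closed in \<open>auto simp: funpow_swap1\<close>)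
      moreover have "(D ^^ (n + m')) (a * D b) = 0"
        by (rule Suc.hyps(1)) (use Suc.hyps(2) Suc.prems nm closed in \<open>auto simp: funpow_swap1\<close>)
      moreover have "n' + m = N" "n + m' = N" using nm Suc.hyps(2) by auto
      moreover have "(D ^^ (n + m)) (a * b) = (D ^^ N) (D a * b + a * D b)"
        using Suc.prems by (simp add: Suc.hyps(2)[symmetric] funpow_swap1 derivation_mult[OF D])
      ultimately show ?thesis
        using closed Suc.prems by (simp add: derivation_iterate_add[OF D] coord_ring_mult)
    qed
  qed
  then show ?thesis using assms by blast
qed

lemma nilpotent_if_image_nilpotent:
  fixes D :: "('i, 'k :: comm_ring_1) operator"
  assumes "\<exists>n. (D ^^ n) (D a) = 0" shows "\<exists>n. (D ^^ n) a = 0"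
  using assms
proof (elim exE)
  fix n assume "(D ^^ n) (D a) = 0"
  then have "(D ^^ Suc n) a = 0" by (simp add: funpow_swap1)
  then show ?thesis by blast
qed

text \<open>
  All lifts of a function on \<open>W\<close> yield the same value because \<open>D\<close> preserves the ideal of \<open>W\<close>; local
  nilpotency descends because iterates of the induced map are restrictions of iterates.
\<close>

lemma LND_descend:
  fixes Z W :: "('i \<Rightarrow> 'k :: comm_ring_1) set"
  assumes WZ: "W \<subseteq> Z" and D: "D \<in> derivations Z"
    and nil: "\<And>a. a \<in> coord_ring Z \<Longrightarrow> \<exists>n. (D ^^ n) a = 0"
    and ideal: "\<And>a. a \<in> coord_ring Z \<Longrightarrow> on_var W a = 0 \<Longrightarrow> on_var W (D a) = 0"
  obtains E where "E \<in> LND W" "\<And>a. a \<in> coord_ring Z \<Longrightarrow> E (on_var W a) = on_var W (D a)"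
proof -
  let ?\<pi> = "on_var W :: (('i \<Rightarrow> 'k) \<Rightarrow> 'k) \<Rightarrow> _"
  have "?\<pi> \<circ> on_var Z = ?\<pi>" using WZ by (auto simp: on_var_def fun_eq_iff)
  then have onto: "coord_ring W = ?\<pi> ` coord_ring Z"
    unfolding coord_ring_def image_comp by simp
  have hom: "?\<pi> (a + b) = ?\<pi> a + ?\<pi> b" "?\<pi> (a * b) = ?\<pi> a * ?\<pi> b" "?\<pi> (scale c a) = scale c (?\<pi> a)"
    for a b c by (auto simp: on_var_def scale_def fun_eq_iff)
  define lift where "lift b = (SOME a. a \<in> coord_ring Z \<and> ?\<pi> a = b)" for b
  define E where "E = (\<lambda>b\<in>coord_ring W. ?\<pi> (D (lift b)))"
  have E: "E (?\<pi> a) = ?\<pi> (D a)" if a: "a \<in> coord_ring Z" for a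
  proof -
    have "lift (?\<pi> a) \<in> coord_ring Z \<and> ?\<pi> (lift (?\<pi> a)) = ?\<pi> a"
      unfolding lift_def by (rule someI[of _ a]) (use a in auto)
    then have l: "lift (?\<pi> a) \<in> coord_ring Z" "?\<pi> (lift (?\<pi> a)) = ?\<pi> a" by auto
    define r where "r = a + scale (-1) (lift (?\<pi> a))"
    have r: "r \<in> coord_ring Z" unfolding r_def by (intro coord_ring_add coord_ring_scale a l)
    have "?\<pi> r = 0" using l by (simp add: r_def hom) (simp add: scale_def fun_eq_iff)
    then have "?\<pi> (D r) = 0" using ideal r by blast
    moreover have "D r = D a + scale (-1) (D (lift (?\<pi> a)))"
      unfolding r_def using derivation_add[OF D] derivation_scale[OF D] a l by (simp add: coord_ring_scale)
    ultimately have "?\<pi> (D a) + scale (-1) (?\<pi> (D (lift (?\<pi> a)))) = 0" by (simp add: hom)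
    then have "?\<pi> (D a) = ?\<pi> (D (lift (?\<pi> a)))"
      by (simp add: scale_def fun_eq_iff)
    moreover have "?\<pi> a \<in> coord_ring W" using a onto by blast
    ultimately show ?thesis by (simp add: E_def)
  qed
  have iter: "(E ^^ n) (?\<pi> a) = ?\<pi> ((D ^^ n) a)" if a: "a \<in> coord_ring Z" for a n
    by (induction n) (simp_all add: E derivation_iterate_closed[OF D a])
  have "E \<in> LND W" unfolding LND_iff derivations_def
  proof (intro conjI CollectI ballI allI)
    show "E \<in> extensional (coord_ring W)" by (simp add: E_def)
    show "E \<in> coord_ring W \<rightarrow> coord_ring W"
    proof
      fix b assume "b \<in> coord_ring W"
      then obtain a where a: "a \<in> coord_ring Z" "b = ?\<pi> a" using onto by blast
      then show "E b \<in> coord_ring W" using derivation_closed[OF D a(1)] by (simp add: E onto)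
    qed
    fix a' c
    assume a': "a' \<in> coord_ring W"
    then obtain a where a: "a \<in> coord_ring Z" "a' = ?\<pi> a" using onto by blast
    obtain n where n: "(D ^^ n) a = 0" using nil[OF a(1)] by (rule exE)
    have "(E ^^ n) a' = ?\<pi> 0" unfolding a(2) iter[OF a(1)] n by (rule refl)
    also have "?\<pi> 0 = 0" by (simp add: on_var_def fun_eq_iff)
    finally show "\<exists>n. (E ^^ n) a' = 0" by (rule exI)
    show "E (scale c a') = scale c (E a')"
      using a E[OF coord_ring_scale[OF a(1), of c]] derivation_scale[OF D a(1), of c] E[OF a(1)]
      by (simp add: hom)
    fix b'
    assume "b' \<in> coord_ring W"
    then obtain b where b: "b \<in> coord_ring Z" "b' = ?\<pi> b" using onto by blast
    show "E (a' + b') = E a' + E b'" "E (a' * b') = E a' * b' + a' * E b'"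
      using a b E[OF coord_ring_add[OF a(1) b(1)]] E[OF coord_ring_mult[OF a(1) b(1)]]
        derivation_add[OF D a(1) b(1)] derivation_mult[OF D a(1) b(1)] E[OF a(1)] E[OF b(1)] by (simp_all add: hom)
  qed
  then show ?thesis using E by (rule that)
qed


section \<open>Taylor polynomials of a locally nilpotent derivation\<close>

text \<open>
  For a locally nilpotent \<open>\<delta>\<close> and a point \<open>x\<close> of the variety the polynomial \<open>\<Sum>\<^sub>n \<delta>\<^sup>n(a)(x)/n! t\<^sup>n\<close> is
  the restriction of \<open>a\<close> to the orbit \<open>t \<mapsto> exp(t\<delta>) x\<close>. As a function of \<open>a\<close> it is a ring homomorphism
  that turns \<open>\<delta>\<close> into \<open>d/dt\<close>; so questions about degrees and about exponentials become
  questions about polynomials in one variable.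
\<close>

definition taylor :: "('i, 'k :: field_char_0) operator \<Rightarrow> ('i \<Rightarrow> 'k) \<Rightarrow> (('i \<Rightarrow> 'k) \<Rightarrow> 'k) \<Rightarrow> 'k poly" where
  "taylor \<delta> x a = (\<Sum>n | (\<delta> ^^ n) a \<noteq> 0. monom ((\<delta> ^^ n) a x / fact n) n)"

lemma finite_nonzero_iterates:
  fixes \<delta> :: "('i, 'k :: comm_ring_1) operator"
  assumes "\<delta> \<in> LND Z" "a \<in> coord_ring Z"
  shows "finite {n. (\<delta> ^^ n) a \<noteq> 0}"
proof -
  obtain N where N: "(\<delta> ^^ N) a = 0" using LND_nilpotent[OF assms] ..
  have "{n. (\<delta> ^^ n) a \<noteq> 0} \<subseteq> {..<N}"
  proof
    fix n assume "n \<in> {n. (\<delta> ^^ n) a \<noteq> 0}"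
    then show "n \<in> {..<N}"
      using derivation_iterate_mono[OF LND_derivation[OF assms(1)] N, of n] by (cases "N \<le> n") auto
  qed
  then show ?thesis by (rule finite_subset) simp
qed

lemma coeff_taylor:
  fixes \<delta> :: "('i, 'k :: field_char_0) operator"
  assumes "\<delta> \<in> LND Z" "a \<in> coord_ring Z"
  shows "coeff (taylor \<delta> x a) n = (\<delta> ^^ n) a x / fact n"
  using finite_nonzero_iterates[OF assms]
  by (auto simp: taylor_def coeff_sum coeff_monom if_distrib sum.delta)

lemma pderiv_taylor:
  fixes \<delta> :: "('i, 'k :: field_char_0) operator"
  assumes "\<delta> \<in> LND Z" "a \<in> coord_ring Z"
  shows "pderiv (taylor \<delta> x a) = taylor \<delta> x (\<delta> a)"
proof (rule poly_eqI)
  fix n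
  have "\<delta> a \<in> coord_ring Z" using derivation_closed[OF LND_derivation[OF assms(1)]] assms(2) by blast
  moreover have "of_nat (Suc n) * (c / fact (Suc n)) = c / fact n" for c :: 'k
    by (simp del: of_nat_Suc)
  ultimately show "coeff (pderiv (taylor \<delta> x a)) n = coeff (taylor \<delta> x (\<delta> a)) n"
    using assms by (simp add: coeff_pderiv coeff_taylor[OF assms(1)] funpow_swap1 del: of_nat_Suc fact_Suc)
qed

lemma poly_taylor_0:
  fixes \<delta> :: "('i, 'k :: field_char_0) operator"
  assumes "\<delta> \<in> LND Z" "a \<in> coord_ring Z"
  shows "poly (taylor \<delta> x a) 0 = a x"
  by (simp add: poly_0_coeff_0 coeff_taylor[OF assms])

lemma taylor_zero:
  fixes \<delta> :: "('i, 'k :: field_char_0) operator"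
  assumes "\<delta> \<in> LND Z" shows "taylor \<delta> x 0 = 0"
  by (rule poly_eqI)
    (simp add: coeff_taylor[OF assms coord_ring_zero] derivation_iterate_zero[OF LND_derivation[OF assms]])

lemma taylor_add:
  fixes \<delta> :: "('i, 'k :: field_char_0) operator"
  assumes "\<delta> \<in> LND Z" "a \<in> coord_ring Z" "b \<in> coord_ring Z"
  shows "taylor \<delta> x (a + b) = taylor \<delta> x a + taylor \<delta> x b"
  by (rule poly_eqI) (simp add: coeff_taylor[OF assms(1)] assms coord_ring_add
      derivation_iterate_add[OF LND_derivation[OF assms(1)] assms(2,3)] add_divide_distrib)

lemma taylor_scale:
  fixes \<delta> :: "('i, 'k :: field_char_0) operator"
  assumes "\<delta> \<in> LND Z" "a \<in> coord_ring Z"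
  shows "taylor \<delta> x (scale c a) = smult c (taylor \<delta> x a)"
proof (rule poly_eqI)
  fix n
  have "(\<delta> ^^ n) (scale c a) = scale c ((\<delta> ^^ n) a)"
    using assms by (intro derivation_iterate_scale LND_derivation)
  then show "coeff (taylor \<delta> x (scale c a)) n = coeff (smult c (taylor \<delta> x a)) n"
    by (simp add: coeff_taylor[OF assms(1)] assms coord_ring_scale) (simp add: scale_def)
qed

text \<open>
  Both sides have the same constant term, and their derivatives are again of the form in
  question; comparing coefficients successively is the binomial Leibniz formula.
\<close>

lemma taylor_mult:
  fixes \<delta> :: "('i, 'k :: field_char_0) operator"
  assumes \<delta>: "\<delta> \<in> LND Z" and ab: "a \<in> coord_ring Z" "b \<in> coord_ring Z"
  shows "taylor \<delta> x (a * b) = taylor \<delta> x a * taylor \<delta> x b"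
proof (rule poly_eqI)
  fix n
  show "coeff (taylor \<delta> x (a * b)) n = coeff (taylor \<delta> x a * taylor \<delta> x b) n"
    using ab
  proof (induction n arbitrary: a b)
    case 0
    have "poly (taylor \<delta> x (a * b)) 0 = poly (taylor \<delta> x a * taylor \<delta> x b) 0"
      using 0 by (simp add: poly_taylor_0[OF \<delta>] coord_ring_mult)
    then show ?case by (simp only: poly_0_coeff_0)
  next
    case (Suc n)
    note D = LND_derivation[OF \<delta>]
    have closed: "\<delta> a \<in> coord_ring Z" "\<delta> b \<in> coord_ring Z" using derivation_closed[OF D] Suc.prems by auto
    have "of_nat (Suc n) * coeff (taylor \<delta> x (a * b)) (Suc n) = coeff (taylor \<delta> x (\<delta> (a * b))) n"
      by (simp add: pderiv_taylor[OF \<delta> coord_ring_mult[OF Suc.prems], symmetric] coeff_pderiv)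
    also have "\<dots> = coeff (taylor \<delta> x (\<delta> a * b)) n + coeff (taylor \<delta> x (a * \<delta> b)) n"
      using Suc.prems closed by (simp add: derivation_mult[OF D] taylor_add[OF \<delta>] coord_ring_mult)
    also have "\<dots> = coeff (taylor \<delta> x (\<delta> a) * taylor \<delta> x b) n + coeff (taylor \<delta> x a * taylor \<delta> x (\<delta> b)) n"
      by (rule arg_cong2[where f = "(+)"]; rule Suc.IH) (use Suc.prems closed in auto)
    also have "\<dots> = coeff (pderiv (taylor \<delta> x a * taylor \<delta> x b)) n"
      using Suc.prems by (simp add: pderiv_mult pderiv_taylor[OF \<delta>] algebra_simps)
    also have "\<dots> = of_nat (Suc n) * coeff (taylor \<delta> x a * taylor \<delta> x b) (Suc n)"
      by (simp add: coeff_pderiv)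
    finally have "coeff (taylor \<delta> x (a * b)) (Suc n) = coeff (taylor \<delta> x a * taylor \<delta> x b) (Suc n)"
      by (simp del: of_nat_Suc)
    then show ?case .
  qed
qed


section \<open>Exponentials and their invariants\<close>

lemma lnd_exp_eq_poly_taylor:
  fixes \<delta> :: "('i, 'k :: field_char_0) operator"
  assumes "\<delta> \<in> LND Z" "a \<in> coord_ring Z"
  shows "lnd_exp Z s \<delta> a x = poly (taylor \<delta> x a) s"
proof -
  have "sum F S x = (\<Sum>n\<in>S. F n x)" for F :: "nat \<Rightarrow> ('i \<Rightarrow> 'k) \<Rightarrow> 'k" and S
    by (induction S rule: infinite_finite_induct) auto
  then show ?thesis
    using assms by (simp add: lnd_exp_def taylor_def poly_sum poly_monom scale_def mult.commute)
qed

lemma lnd_exp_closed: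
  fixes \<delta> :: "('i, 'k :: field_char_0) operator"
  assumes "\<delta> \<in> LND Z" "a \<in> coord_ring Z"
  shows "lnd_exp Z s \<delta> a \<in> coord_ring Z"
  using assms unfolding lnd_exp_def
  by (auto intro!: coord_ring_sum coord_ring_scale derivation_iterate_closed LND_derivation)

lemma lnd_exp_hom:
  fixes \<delta> :: "('i, 'k :: field_char_0) operator"
  assumes "\<delta> \<in> LND Z" "a \<in> coord_ring Z" "b \<in> coord_ring Z"
  shows "lnd_exp Z s \<delta> (a + b) = lnd_exp Z s \<delta> a + lnd_exp Z s \<delta> b"
    "lnd_exp Z s \<delta> (a * b) = lnd_exp Z s \<delta> a * lnd_exp Z s \<delta> b"
    "lnd_exp Z s \<delta> (scale c a) = scale c (lnd_exp Z s \<delta> a)"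
  using assms
  by (simp_all add: fun_eq_iff lnd_exp_eq_poly_taylor coord_ring_add coord_ring_mult
      coord_ring_scale taylor_add taylor_mult taylor_scale, simp add: scale_def lnd_exp_eq_poly_taylor)

lemma lnd_exp_kernel:
  fixes \<delta> :: "('i, 'k :: field_char_0) operator"
  assumes \<delta>: "\<delta> \<in> LND Z" and a: "a \<in> coord_ring Z" "\<delta> a = 0"
  shows "lnd_exp Z s \<delta> a = a"
proof
  fix x
  have "pderiv (taylor \<delta> x a) = 0"
    by (simp only: pderiv_taylor[OF \<delta> a(1)] a(2) taylor_zero[OF \<delta>])
  then obtain c where "taylor \<delta> x a = [:c:]" by (metis pderiv_eq_0_iff degree_eq_zeroE)
  then show "lnd_exp Z s \<delta> a x = a x"
    using poly_taylor_0[OF \<delta> a(1), of x] lnd_exp_eq_poly_taylor[OF \<delta> a(1), of s x] by simp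
qed

lemma lnd_exp_commute:
  fixes \<delta> :: "('i, 'k :: field_char_0) operator"
  assumes \<delta>: "\<delta> \<in> LND Z" and a: "a \<in> coord_ring Z"
  shows "\<delta> (lnd_exp Z s \<delta> a) = lnd_exp Z s \<delta> (\<delta> a)"
proof -
  note D = LND_derivation[OF \<delta>]
  obtain N where N: "(\<delta> ^^ N) a = 0" using LND_nilpotent[OF \<delta> a] ..
  have trunc: "lnd_exp Z s \<delta> b = (\<Sum>n<N. scale (s ^ n / fact n) ((\<delta> ^^ n) b))"
    if b: "b \<in> coord_ring Z" "(\<delta> ^^ N) b = 0" for b
  proof -
    have "n < N" if "(\<delta> ^^ n) b \<noteq> 0" for n
      using derivation_iterate_mono[OF D b(2)] that by (meson not_le)
    then have "(\<Sum>n | (\<delta> ^^ n) b \<noteq> 0. scale (s ^ n / fact n) ((\<delta> ^^ n) b)) =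
        (\<Sum>n<N. scale (s ^ n / fact n) ((\<delta> ^^ n) b))"
      by (intro sum.mono_neutral_left) (auto simp: scale_def fun_eq_iff)
    then show ?thesis using b by (simp add: lnd_exp_def)
  qed
  have "(\<delta> ^^ N) (\<delta> a) = 0"
    using N derivation_zero[OF D] by (simp flip: funpow_swap1)
  then show ?thesis
    using a N derivation_closed[OF D a] derivation_iterate_closed[OF D a]
    by (simp add: trunc derivation_sum[OF D] coord_ring_scale derivation_scale[OF D] funpow_swap1)
qed

text \<open>
  Pulling back by \<open>exp(s\<delta>)\<close> shifts the time parameter on the orbit of \<open>x\<close> by \<open>s\<close>; the two polynomials
  agree at \<open>0\<close>, and so do their derivatives by induction on the order of \<open>\<delta>\<close> at \<open>a\<close>.
\<close>

lemma taylor_lnd_exp: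
  fixes \<delta> :: "('i, 'k :: field_char_0) operator"
  assumes \<delta>: "\<delta> \<in> LND Z" and a: "a \<in> coord_ring Z"
  shows "taylor \<delta> x (lnd_exp Z s \<delta> a) = pcompose (taylor \<delta> x a) [:s, 1:]"
proof -
  note D = LND_derivation[OF \<delta>]
  have "taylor \<delta> x (lnd_exp Z s \<delta> a) = pcompose (taylor \<delta> x a) [:s, 1:]"
    if "(\<delta> ^^ n) a = 0" "a \<in> coord_ring Z" for n a
    using that
  proof (induction n arbitrary: a)
    case 0
    have "a = 0" using 0(1) by (simp only: funpow.simps id_apply)
    moreover have "\<delta> 0 = 0" by (rule derivation_zero[OF D])
    then have "lnd_exp Z s \<delta> 0 = 0" by (rule lnd_exp_kernel[OF \<delta> coord_ring_zero])
    ultimately show ?case by (simp only: taylor_zero[OF \<delta>] pcompose_0)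
  next
    case (Suc n)
    have \<delta>a: "\<delta> a \<in> coord_ring Z" by (rule derivation_closed[OF D Suc.prems(2)])
    have ea: "lnd_exp Z s \<delta> a \<in> coord_ring Z" by (rule lnd_exp_closed[OF \<delta> Suc.prems(2)])
    let ?d = "taylor \<delta> x (lnd_exp Z s \<delta> a) - pcompose (taylor \<delta> x a) [:s, 1:]"
    have "taylor \<delta> x (lnd_exp Z s \<delta> (\<delta> a)) = pcompose (taylor \<delta> x (\<delta> a)) [:s, 1:]"
      by (rule Suc.IH[OF _ \<delta>a]) (use Suc.prems(1) in \<open>simp only: funpow_Suc_right o_apply\<close>)
    then have "pderiv ?d = 0"
      using Suc.prems ea
      by (simp add: pderiv_diff pderiv_taylor[OF \<delta>] pderiv_pcompose pderiv_pCons lnd_exp_commute[OF \<delta>])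
    then obtain c where c: "?d = [:c:]" by (metis pderiv_eq_0_iff degree_eq_zeroE)
    have "poly ?d 0 = 0"
      using Suc.prems ea
      by (simp add: poly_taylor_0[OF \<delta>] poly_pcompose lnd_exp_eq_poly_taylor[OF \<delta>])
    then have "c = 0" unfolding c by simp
    then show ?case using c by simp
  qed
  then show ?thesis using LND_nilpotent[OF \<delta> a] a by blast
qed

lemma lnd_exp_inverse:
  fixes \<delta> :: "('i, 'k :: field_char_0) operator"
  assumes "\<delta> \<in> LND Z" "a \<in> coord_ring Z"
  shows "lnd_exp Z (- s) \<delta> (lnd_exp Z s \<delta> a) = a"
  by (rule ext) (simp add: lnd_exp_eq_poly_taylor[OF assms(1)] lnd_exp_closed[OF assms]
      taylor_lnd_exp[OF assms] poly_pcompose poly_taylor_0[OF assms])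

lemma lnd_exp_in_Aut:
  fixes \<delta> :: "('i, 'k :: field_char_0) operator"
  assumes \<delta>: "\<delta> \<in> LND Z"
  shows "lnd_exp Z s \<delta> \<in> carrier (Aut Z)"
proof -
  have "bij_betw (lnd_exp Z s \<delta>) (coord_ring Z) (coord_ring Z)"
    by (rule bij_betw_byWitness[where f' = "lnd_exp Z (- s) \<delta>"])
      (use lnd_exp_inverse[OF \<delta>, of _ s] lnd_exp_inverse[OF \<delta>, of _ "- s"] lnd_exp_closed[OF \<delta>] in auto)
  moreover have "lnd_exp Z s \<delta> \<in> extensional (coord_ring Z)" by (simp add: lnd_exp_def)
  ultimately show ?thesis using lnd_exp_hom[OF \<delta>] by (simp add: Aut_def Bij_def)
qed

lemma group_Aut: "group (Aut Z)"
proof -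
  define H where "H = carrier (Aut Z)"
  have H: "\<phi> \<in> H \<longleftrightarrow> \<phi> \<in> Bij (coord_ring Z) \<and>
     (\<forall>a\<in>coord_ring Z. \<forall>b\<in>coord_ring Z. \<phi> (a + b) = \<phi> a + \<phi> b) \<and>
     (\<forall>c. \<forall>a\<in>coord_ring Z. \<phi> (scale c a) = scale c (\<phi> a)) \<and>
     (\<forall>a\<in>coord_ring Z. \<forall>b\<in>coord_ring Z. \<phi> (a * b) = \<phi> a * \<phi> b)" for \<phi>
    by (simp add: H_def Aut_def)
  have closed: "\<phi> a \<in> coord_ring Z" if "\<phi> \<in> H" "a \<in> coord_ring Z" for \<phi> a
    using that Bij_imp_funcset unfolding H by blast
  interpret B: group "BijGroup (coord_ring Z)" by (rule group_BijGroup)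
  have "subgroup H (BijGroup (coord_ring Z))"
  proof (rule B.subgroupI)
    show "H \<subseteq> carrier (BijGroup (coord_ring Z))" by (auto simp: H BijGroup_def)
    have "(\<lambda>a\<in>coord_ring Z. a) \<in> H"
      by (simp add: H id_Bij coord_ring_add coord_ring_mult coord_ring_scale)
    then show "H \<noteq> {}" by blast
  next
    fix \<phi> assume \<phi>: "\<phi> \<in> H"
    let ?\<psi> = "\<lambda>a\<in>coord_ring Z. inv_into (coord_ring Z) \<phi> a"
    have bij: "\<phi> \<in> Bij (coord_ring Z)" using \<phi> H by blast
    have inj: "inj_on \<phi> (coord_ring Z)" and im: "\<phi> ` coord_ring Z = coord_ring Z"
      using bij by (auto simp: Bij_def bij_betw_def)
    have r: "?\<psi> (\<phi> a) = a" if "a \<in> coord_ring Z" for a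
      using that inj closed[OF \<phi>] by simp
    have "?\<psi> \<in> H" unfolding H
    proof (intro conjI ballI allI)
      show "?\<psi> \<in> Bij (coord_ring Z)" using bij by (rule restrict_inv_into_Bij)
      fix a' c assume "a' \<in> coord_ring Z"
      then obtain a where a: "a \<in> coord_ring Z" "a' = \<phi> a" using im by blast
      have "scale c a' = \<phi> (scale c a)" using a \<phi> unfolding H by simp
      then show "?\<psi> (scale c a') = scale c (?\<psi> a')" using a r coord_ring_scale by metis
      fix b' assume "b' \<in> coord_ring Z"
      then obtain b where b: "b \<in> coord_ring Z" "b' = \<phi> b" using im by blast
      have "a' + b' = \<phi> (a + b)" "a' * b' = \<phi> (a * b)" using a b \<phi> unfolding H by simp_all
      then show "?\<psi> (a' + b') = ?\<psi> a' + ?\<psi> b'" "?\<psi> (a' * b') = ?\<psi> a' * ?\<psi> b'"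
        using a b r coord_ring_add coord_ring_mult by metis+
    qed
    then show "inv\<^bsub>BijGroup (coord_ring Z)\<^esub> \<phi> \<in> H" using inv_BijGroup[OF bij] by simp
  next
    fix \<phi> \<psi> assume *: "\<phi> \<in> H" "\<psi> \<in> H"
    then have "\<phi> \<otimes>\<^bsub>BijGroup (coord_ring Z)\<^esub> \<psi> = compose (coord_ring Z) \<phi> \<psi>"
      by (simp add: BijGroup_def H)
    moreover have "compose (coord_ring Z) \<phi> \<psi> \<in> H"
      unfolding H using * closed[OF *(2)]
      by (intro conjI compose_Bij) (auto simp: H compose_def coord_ring_add coord_ring_mult coord_ring_scale)
    ultimately show "\<phi> \<otimes>\<^bsub>BijGroup (coord_ring Z)\<^esub> \<psi> \<in> H" by simp
  qed
  then have "group ((BijGroup (coord_ring Z))\<lparr>carrier := H\<rparr>)"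
    by (rule subgroup.subgroup_is_group) (rule group_BijGroup)
  then show ?thesis by (simp add: H_def Aut_def)
qed

lemma stabiliser_subgroup:
  assumes a: "a \<in> coord_ring Z"
  shows "subgroup {\<phi> \<in> carrier (Aut Z). \<phi> a = a} (Aut Z)"
proof -
  interpret A: group "Aut Z" by (rule group_Aut)
  have mult: "(\<phi> \<otimes>\<^bsub>Aut Z\<^esub> \<psi>) a = \<phi> (\<psi> a)" if "\<phi> \<in> carrier (Aut Z)" "\<psi> \<in> carrier (Aut Z)" for \<phi> \<psi>
    using that a by (auto simp: Aut_def BijGroup_def compose_def)
  have one: "\<one>\<^bsub>Aut Z\<^esub> a = a" using a by (simp add: Aut_def BijGroup_def)
  show ?thesis
  proof (rule A.subgroupI)
    show "{\<phi> \<in> carrier (Aut Z). \<phi> a = a} \<noteq> {}" using one A.one_closed by blast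
    fix \<phi> assume "\<phi> \<in> {\<phi> \<in> carrier (Aut Z). \<phi> a = a}"
    then show "inv\<^bsub>Aut Z\<^esub> \<phi> \<in> {\<phi> \<in> carrier (Aut Z). \<phi> a = a}"
      using mult[of "inv\<^bsub>Aut Z\<^esub> \<phi>" \<phi>] one by auto
  qed (auto simp: mult)
qed

lemma lnd_degree_eq_1_iff:
  fixes \<delta> :: "('i, 'k :: comm_ring_1) operator"
  assumes \<delta>: "\<delta> \<in> LND Z" and f: "f \<in> coord_ring Z"
  shows "lnd_degree \<delta> f = 1 \<longleftrightarrow> \<delta> f \<noteq> 0 \<and> \<delta> (\<delta> f) = 0"
proof -
  note D = LND_derivation[OF \<delta>]
  obtain n where n: "(\<delta> ^^ n) f = 0" using LND_nilpotent[OF \<delta> f] ..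
  have n1: "(\<delta> ^^ (n + 1)) f = 0" by (rule derivation_iterate_mono[OF D n]) simp
  have L: "(\<delta> ^^ (lnd_degree \<delta> f + 1)) f = 0" unfolding lnd_degree_def
    by (rule LeastI[of "\<lambda>n. (\<delta> ^^ (n + 1)) f = 0", OF n1])
  show ?thesis
  proof
    assume 1: "lnd_degree \<delta> f = 1"
    have "\<not> (\<delta> ^^ (0 + 1)) f = 0"
      by (rule not_less_Least[of 0 "\<lambda>n. (\<delta> ^^ (n + 1)) f = 0"]) (use 1 in \<open>simp add: lnd_degree_def\<close>)
    then show "\<delta> f \<noteq> 0 \<and> \<delta> (\<delta> f) = 0" using L 1 by simp
  next
    assume 2: "\<delta> f \<noteq> 0 \<and> \<delta> (\<delta> f) = 0"
    show "lnd_degree \<delta> f = 1" unfolding lnd_degree_def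
    proof (rule Least_equality)
      show "1 \<le> m" if "(\<delta> ^^ (m + 1)) f = 0" for m using that 2 by (cases m) auto
    qed (use 2 in simp)
  qed
qed

text \<open>
  The exponential \<open>exp(s\<delta>)\<close> fixes the kernel of \<open>\<delta>\<close>, and the stabiliser of \<open>a\<close> is a subgroup. That the
  exponentials are automorphisms enters because the generated group contains their inverses.
\<close>

lemma kernels_subset_invariants_G1:
  fixes f a :: "('i \<Rightarrow> 'k :: field_char_0) \<Rightarrow> 'k"
  assumes f: "f \<in> coord_ring Z" and a: "a \<in> coord_ring Z"
    and ker: "\<And>\<delta>. \<delta> \<in> LND Z \<Longrightarrow> \<delta> f \<noteq> 0 \<Longrightarrow> \<delta> (\<delta> f) = 0 \<Longrightarrow> \<delta> a = 0"
  shows "a \<in> invariants Z (G1 Z f)"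
proof -
  interpret A: group "Aut Z" by (rule group_Aut)
  let ?z = "(\<lambda>a\<in>coord_ring Z. 0) :: ('i, 'k) operator"
  have "?z \<in> LND Z"
  proof -
    have "\<exists>n. (?z ^^ n) b = 0" if "b \<in> coord_ring Z" for b
      by (rule exI[of _ "Suc 0"], simp only: funpow.simps o_apply id_apply) (simp add: that)
    then show ?thesis
      by (simp add: LND_iff derivations_def scale_zero coord_ring_zero coord_ring_add coord_ring_mult coord_ring_scale)
  qed
  have "lnd_exp Z s \<delta> \<in> carrier (Aut Z) \<and> lnd_exp Z s \<delta> a = a" if "\<delta> \<in> N1 Z f" for \<delta> s
  proof (cases "\<delta> = ?z")
    case True
    then show ?thesis
      using lnd_exp_in_Aut[OF \<open>?z \<in> LND Z\<close>] lnd_exp_kernel[OF \<open>?z \<in> LND Z\<close> a] a by simp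
  next
    case False
    then have \<delta>: "\<delta> \<in> LND Z" "lnd_degree \<delta> f = 1" using that by (simp_all add: N1_def)
    have "\<delta> f \<noteq> 0 \<and> \<delta> (\<delta> f) = 0" by (rule iffD1[OF lnd_degree_eq_1_iff[OF \<delta>(1) f] \<delta>(2)])
    then have "\<delta> a = 0" by (elim conjE) (rule ker[OF \<delta>(1)])
    then show ?thesis using lnd_exp_in_Aut[OF \<delta>(1)] lnd_exp_kernel[OF \<delta>(1) a] by simp
  qed
  then have "(\<Union>\<delta>\<in>N1 Z f. {lnd_exp Z s \<delta> | s. True}) \<subseteq> {\<phi> \<in> carrier (Aut Z). \<phi> a = a}"
    by auto
  then have "G1 Z f \<subseteq> {\<phi> \<in> carrier (Aut Z). \<phi> a = a}"
    unfolding G1_def by (intro A.generate_subgroup_incl stabiliser_subgroup a)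
  then show ?thesis using a by (auto simp: invariants_def)
qed


section \<open>Derivations of the cylinder\<close>

definition y_monomial :: "('n \<Rightarrow> 'k :: comm_ring_1) set \<Rightarrow> ('m :: finite \<Rightarrow> nat) \<Rightarrow> ('n + 'm \<Rightarrow> 'k) \<Rightarrow> 'k" where
  "y_monomial X \<alpha> = on_var (cylinder X) (\<lambda>z. mono_fun \<alpha> (z \<circ> Inr))"

abbreviation unit_exponent :: "'m \<Rightarrow> 'm \<Rightarrow> nat" where
  "unit_exponent j \<equiv> (\<lambda>_. 0)(j := Suc 0)"

lemma mono_fun_upd_exponent:
  "mono_fun (\<alpha>(i := n)) (y :: 'm :: finite \<Rightarrow> 'k :: comm_ring_1) = y i ^ n * mono_fun (\<alpha>(i := 0)) y"
proof -
  have "mono_fun (\<alpha>(i := m)) y = y i ^ m * (\<Prod>j\<in>UNIV - {i}. y j ^ \<alpha> j)" for m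
    unfolding mono_fun_def by (subst prod.remove[of _ i]) auto
  then show ?thesis by simp
qed

lemma mono_fun_upd_point:
  "mono_fun (\<alpha>(i := 0)) ((y :: 'm :: finite \<Rightarrow> 'k :: comm_ring_1)(i := t)) = mono_fun (\<alpha>(i := 0)) y"
  unfolding mono_fun_def by (rule prod.cong) auto

lemma mono_fun_unit: "mono_fun (unit_exponent j) y = y j"
  using mono_fun_upd_exponent[of "\<lambda>_. 0" j "Suc 0" y] by (simp add: mono_fun_def)

lemma y_monomial_closed:
  fixes X :: "('n \<Rightarrow> 'k :: comm_ring_1) set" and \<alpha> :: "'m :: finite \<Rightarrow> nat"
  shows "y_monomial X \<alpha> \<in> coord_ring (cylinder X)"
proof -
  have "(\<lambda>z :: 'n + 'm \<Rightarrow> 'k. mono_fun \<alpha> (z \<circ> Inr)) \<in> poly_funs"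
    unfolding mono_fun_def o_def by (intro poly_funs_prod poly_funs_power poly_funs.coord)
  then show ?thesis by (simp add: y_monomial_def coord_ring_def)
qed

lemma y_monomial_upd_Suc:
  fixes X :: "('n \<Rightarrow> 'k :: comm_ring_1) set" and \<alpha> :: "'m :: finite \<Rightarrow> nat"
  shows "y_monomial X (\<alpha>(i := Suc n)) = y_monomial X (\<alpha>(i := n)) * y_monomial X (unit_exponent i)"
proof
  fix z :: "'n + 'm \<Rightarrow> 'k"
  show "y_monomial X (\<alpha>(i := Suc n)) z = (y_monomial X (\<alpha>(i := n)) * y_monomial X (unit_exponent i)) z"
    using mono_fun_upd_exponent[of \<alpha> i "Suc n" "z \<circ> Inr"] mono_fun_upd_exponent[of \<alpha> i n "z \<circ> Inr"]
    by (simp add: y_monomial_def on_var_def mono_fun_unit del: fun_upd_apply)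
qed

text \<open>
  The algebra \<open>\<K>[X][y]\<close> is generated by \<open>\<K>[X]\<close> and the \<open>y\<^sub>j\<close>. Both the closure properties and the
  nilpotency of the operators below are checked on these generators.
\<close>

lemma coord_ring_cylinder_induct [consumes 1, case_names pullback coord add mult]:
  fixes X :: "('n \<Rightarrow> 'k :: comm_ring_1) set" and P :: "(('n + 'm :: finite \<Rightarrow> 'k) \<Rightarrow> 'k) \<Rightarrow> bool"
  assumes h: "h \<in> coord_ring (cylinder X)"
    and pullback: "\<And>a. a \<in> coord_ring X \<Longrightarrow> P (pullback a)"
    and coord: "\<And>j. P (y_monomial X (unit_exponent j))"
    and add: "\<And>g h. g \<in> coord_ring (cylinder X) \<Longrightarrow> h \<in> coord_ring (cylinder X) \<Longrightarrow> P g \<Longrightarrow> P h \<Longrightarrow> P (g + h)"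
    and mult: "\<And>g h. g \<in> coord_ring (cylinder X) \<Longrightarrow> h \<in> coord_ring (cylinder X) \<Longrightarrow> P g \<Longrightarrow> P h \<Longrightarrow> P (g * h)"
  shows "P h"
proof -
  have "P (on_var (cylinder X) p)" if "p \<in> poly_funs" for p
    using that
  proof (induction rule: poly_funs.induct)
    case (const c)
    have "on_var (cylinder X) (\<lambda>_. c) = (pullback (on_var X (\<lambda>_. c)) :: ('n + 'm \<Rightarrow> 'k) \<Rightarrow> 'k)"
      by (rule ext) (simp add: on_var_def cylinder_def pullback_def)
    then show ?case using pullback[OF coord_ring_const, of c] by simp
  next
    case (coord i)
    show ?case
    proof (cases i)
      case (Inl i')
      have "on_var (cylinder X) (\<lambda>x. x i) = (pullback (on_var X (\<lambda>x. x i')) :: ('n + 'm \<Rightarrow> 'k) \<Rightarrow> 'k)"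
        by (rule ext) (simp add: on_var_def cylinder_def pullback_def Inl)
      moreover have "on_var X (\<lambda>x. x i') \<in> coord_ring X"
        by (simp add: coord_ring_def poly_funs.coord)
      ultimately show ?thesis using pullback by simp
    next
      case (Inr j)
      have "on_var (cylinder X) (\<lambda>x. x i) = y_monomial X (unit_exponent j)"
        by (rule ext) (simp add: y_monomial_def on_var_def mono_fun_unit Inr)
      then show ?thesis using assms(3) by simp
    qed
  next
    case (add p q)
    have "on_var (cylinder X) (p + q) = on_var (cylinder X) p + on_var (cylinder X) q"
      by (rule ext) (simp add: on_var_def)
    moreover have "P (on_var (cylinder X) p + on_var (cylinder X) q)"
      by (rule assms(4)) (use add in \<open>simp_all add: coord_ring_def\<close>)
    ultimately show ?case by (simp only:)
  next
    case (mult p q)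
    have "on_var (cylinder X) (p * q) = on_var (cylinder X) p * on_var (cylinder X) q"
      by (rule ext) (simp add: on_var_def)
    moreover have "P (on_var (cylinder X) p * on_var (cylinder X) q)"
      by (rule assms(5)) (use mult in \<open>simp_all add: coord_ring_def\<close>)
    ultimately show ?case by (simp only:)
  qed
  then show ?thesis using h by (auto simp: coord_ring_def)
qed

text \<open>
  The extension of a derivation \<open>\<delta>\<close> of \<open>\<K>[X]\<close> to \<open>\<K>[X][y]\<close> that kills all \<open>y\<^sub>j\<close> applies \<open>\<delta>\<close> to the
  coefficients; equivalently it applies \<open>\<delta>\<close> to the restriction to each slice \<open>X \<times> {y}\<close>. The latter
  makes sense for functions without the choice of an expansion in the \<open>y\<^sub>j\<close>.
\<close>

definition fibrewise :: "('n, 'k) operator \<Rightarrow> ('n + 'm, 'k) operator" where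
  "fibrewise \<delta> h = (\<lambda>z. \<delta> (\<lambda>x. h (case_sum x (z \<circ> Inr))) (z \<circ> Inl))"

lemma case_sum_comp: "case_sum x y \<circ> Inl = x" "case_sum x y \<circ> Inr = y"
  by (simp_all add: fun_eq_iff)

lemma slice_in_coord_ring:
  fixes X :: "('n \<Rightarrow> 'k :: comm_ring_1) set" and h :: "('n + 'm :: finite \<Rightarrow> 'k) \<Rightarrow> 'k"
  assumes "h \<in> coord_ring (cylinder X)"
  shows "(\<lambda>x. h (case_sum x y)) \<in> coord_ring X"
  using assms
proof (induction rule: coord_ring_cylinder_induct)
  case (pullback a)
  then show ?case by (simp add: pullback_def case_sum_comp)
next
  case (coord j)
  have "(\<lambda>x. y_monomial X (unit_exponent j) (case_sum x y)) = on_var X (\<lambda>_. y j)"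
    by (rule ext) (simp add: y_monomial_def mono_fun_unit on_var_def cylinder_def case_sum_comp)
  then show ?case by (simp only: coord_ring_const)
next
  case (add g h)
  have "(\<lambda>x. g (case_sum x y)) + (\<lambda>x. h (case_sum x y)) \<in> coord_ring X"
    by (rule coord_ring_add[OF add.IH])
  then show ?case by (simp add: plus_fun_def)
next
  case (mult g h)
  have "(\<lambda>x. g (case_sum x y)) * (\<lambda>x. h (case_sum x y)) \<in> coord_ring X"
    by (rule coord_ring_mult[OF mult.IH])
  then show ?case by (simp add: times_fun_def)
qed

context
  fixes X :: "('n \<Rightarrow> 'k :: comm_ring_1) set" and \<delta> :: "('n, 'k) operator"
  assumes \<delta>: "\<delta> \<in> derivations X"
begin

lemma fibrewise_pullback: "fibrewise \<delta> (pullback a :: ('n + 'm :: finite \<Rightarrow> 'k) \<Rightarrow> 'k) = pullback (\<delta> a)"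
  by (rule ext) (simp add: fibrewise_def pullback_def case_sum_comp)

lemma fibrewise_y_monomial: "fibrewise \<delta> (y_monomial X \<alpha> :: ('n + 'm :: finite \<Rightarrow> 'k) \<Rightarrow> 'k) = 0"
proof
  fix z :: "'n + 'm \<Rightarrow> 'k"
  have "(\<lambda>x. y_monomial X \<alpha> (case_sum x (z \<circ> Inr))) = on_var X (\<lambda>_. mono_fun \<alpha> (z \<circ> Inr))"
    by (rule ext) (simp add: y_monomial_def on_var_def cylinder_def case_sum_comp)
  then show "fibrewise \<delta> (y_monomial X \<alpha>) z = 0 z"
    by (simp add: fibrewise_def derivation_const[OF \<delta>])
qed

lemma fibrewise_derivation: "fibrewise \<delta> \<in> derivations (cylinder X :: ('n + 'm :: finite \<Rightarrow> 'k) set)"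
proof -
  let ?R = "coord_ring (cylinder X :: ('n + 'm \<Rightarrow> 'k) set)"
  have sum_rule: "fibrewise \<delta> (g + h) = fibrewise \<delta> g + fibrewise \<delta> h" if "g \<in> ?R" "h \<in> ?R" for g h
  proof
    fix z :: "'n + 'm \<Rightarrow> 'k"
    show "fibrewise \<delta> (g + h) z = (fibrewise \<delta> g + fibrewise \<delta> h) z"
      using derivation_add[OF \<delta> slice_in_coord_ring[OF that(1)] slice_in_coord_ring[OF that(2)],
          of "z \<circ> Inr" "z \<circ> Inr"]
      by (simp add: fibrewise_def plus_fun_def)
  qed
  have product_rule: "fibrewise \<delta> (g * h) = fibrewise \<delta> g * h + g * fibrewise \<delta> h" if "g \<in> ?R" "h \<in> ?R" for g h
  proof
    fix z :: "'n + 'm \<Rightarrow> 'k"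
    have "case_sum (z \<circ> Inl) (z \<circ> Inr) = z" by (auto simp: fun_eq_iff split: sum.split)
    then show "fibrewise \<delta> (g * h) z = (fibrewise \<delta> g * h + g * fibrewise \<delta> h) z"
      using derivation_mult[OF \<delta> slice_in_coord_ring[OF that(1)] slice_in_coord_ring[OF that(2)],
          of "z \<circ> Inr" "z \<circ> Inr"]
      by (simp add: fibrewise_def plus_fun_def times_fun_def)
  qed
  have scale_rule: "fibrewise \<delta> (scale c h) = scale c (fibrewise \<delta> h)" if "h \<in> ?R" for c h
  proof
    fix z :: "'n + 'm \<Rightarrow> 'k"
    show "fibrewise \<delta> (scale c h) z = scale c (fibrewise \<delta> h) z"
      using derivation_scale[OF \<delta> slice_in_coord_ring[OF that], of c "z \<circ> Inr"]
      by (simp add: fibrewise_def scale_def)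
  qed
  have "fibrewise \<delta> h \<in> ?R" if "h \<in> ?R" for h
    using that
  proof (induction rule: coord_ring_cylinder_induct)
    case (pullback a)
    then show ?case by (simp only: fibrewise_pullback coord_ring_pullback derivation_closed[OF \<delta>])
  next
    case (coord j)
    show ?case by (simp only: fibrewise_y_monomial coord_ring_zero)
  next
    case (add g h)
    have "fibrewise \<delta> (g + h) \<in> ?R"
      unfolding sum_rule[OF add.hyps] by (rule coord_ring_add[OF add.IH])
    then show ?case .
  next
    case (mult g h)
    have "fibrewise \<delta> (g * h) \<in> ?R"
      unfolding product_rule[OF mult.hyps]
      by (intro coord_ring_add coord_ring_mult mult.IH mult.hyps)
    then show ?case .
  qed
  then show ?thesis unfolding derivations_def using sum_rule product_rule scale_rule by simp
qed

end

text \<open>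
  Partial derivatives of functions are formed along coordinate lines: over an infinite field a
  polynomial on a line is determined by its values.
\<close>

definition partial :: "'i \<Rightarrow> ('i, 'k :: field_char_0) operator" where
  "partial c h z = poly (pderiv (THE p. \<forall>t. poly p t = h (z(c := t)))) (z c)"

lemma partial_eq:
  assumes "\<And>t. poly p t = h (z(c := t))"
  shows "partial c h z = poly (pderiv p) (z c)"
proof -
  have "(THE p. \<forall>t. poly p t = h (z(c := t))) = p"
  proof (rule the_equality)
    fix q assume "\<forall>t. poly q t = h (z(c := t))"
    then have "poly q = poly p" using assms by (simp add: fun_eq_iff)
    then show "q = p" by (simp only: poly_eq_poly_eq_iff)
  qed (use assms in simp)
  then show ?thesis by (simp add: partial_def)
qed

lemma cylinder_upd: "z(Inr i := t) \<in> cylinder X \<longleftrightarrow> z \<in> cylinder X" "z(Inr i := t) \<circ> Inl = z \<circ> Inl"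
    "z(Inr i := t) \<circ> Inr = (z \<circ> Inr)(i := t)"
  by (auto simp: cylinder_def fun_eq_iff comp_def)

lemma partial_pullback:
  "partial (Inr i) (pullback a :: ('n + 'm \<Rightarrow> 'k :: field_char_0) \<Rightarrow> 'k) = 0"
  by (rule ext) (subst partial_eq[where p = "[:pullback a _:]"], simp_all add: pullback_def cylinder_upd pderiv_pCons)

lemma y_monomial_line:
  fixes X :: "('n \<Rightarrow> 'k :: field_char_0) set" and z :: "'n + 'm :: finite \<Rightarrow> 'k"
  assumes "z \<in> cylinder X"
  shows "poly (monom (mono_fun (\<alpha>(i := 0)) (z \<circ> Inr)) (\<alpha> i)) t = y_monomial X \<alpha> (z(Inr i := t))"
  using assms mono_fun_upd_exponent[of \<alpha> i "\<alpha> i" "(z \<circ> Inr)(i := t)"] mono_fun_upd_point[of \<alpha> i "z \<circ> Inr" t]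
  by (simp add: y_monomial_def on_var_def cylinder_upd poly_monom mult.commute)

lemma partial_y_monomial:
  fixes X :: "('n \<Rightarrow> 'k :: field_char_0) set" and \<alpha> :: "'m :: finite \<Rightarrow> nat"
  shows "partial (Inr i) (y_monomial X \<alpha>) = scale (of_nat (\<alpha> i)) (y_monomial X (\<alpha>(i := \<alpha> i - 1)))"
proof
  fix z :: "'n + 'm \<Rightarrow> 'k"
  show "partial (Inr i) (y_monomial X \<alpha>) z = scale (of_nat (\<alpha> i)) (y_monomial X (\<alpha>(i := \<alpha> i - 1))) z"
  proof (cases "z \<in> cylinder X")
    case True
    show ?thesis
      unfolding partial_eq[where h = "y_monomial X \<alpha>", OF y_monomial_line[OF True]]
      using True mono_fun_upd_exponent[of \<alpha> i "\<alpha> i - 1" "z \<circ> Inr"]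
      by (simp add: scale_def y_monomial_def on_var_def pderiv_monom poly_monom)
  next
    case False
    then have "partial (Inr i) (y_monomial X \<alpha>) z = poly (pderiv 0) (z (Inr i))"
      by (intro partial_eq) (simp add: y_monomial_def on_var_def cylinder_upd)
    then show ?thesis using False by (simp add: scale_def y_monomial_def on_var_def)
  qed
qed

lemma polynomial_on_line:
  fixes X :: "('n \<Rightarrow> 'k :: field_char_0) set" and h :: "('n + 'm :: finite \<Rightarrow> 'k) \<Rightarrow> 'k"
  assumes "h \<in> coord_ring (cylinder X)"
  shows "\<exists>p. \<forall>t. poly p t = h (z(Inr i := t))"
  using assms
proof (induction rule: coord_ring_cylinder_induct)
  case (pullback a)
  show ?case by (rule exI[of _ "[:a (z \<circ> Inl):]"]) (simp add: pullback_def cylinder_upd del: fun_upd_apply)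
next
  case (coord j)
  show ?case
  proof (cases "z \<in> cylinder X")
    case True
    show ?thesis by (intro exI allI) (rule y_monomial_line[OF True])
  next
    case False
    then show ?thesis
      by (intro exI[of _ 0]) (simp add: y_monomial_def on_var_def cylinder_upd del: fun_upd_apply)
  qed
next
  case (add g h)
  obtain p q where "\<forall>t. poly p t = g (z(Inr i := t))" "\<forall>t. poly q t = h (z(Inr i := t))"
    using add.IH by (elim exE)
  then show ?case by (intro exI[of _ "p + q"]) (simp del: fun_upd_apply)
next
  case (mult g h)
  obtain p q where "\<forall>t. poly p t = g (z(Inr i := t))" "\<forall>t. poly q t = h (z(Inr i := t))"
    using mult.IH by (elim exE)
  then show ?case by (intro exI[of _ "p * q"]) (simp del: fun_upd_apply)
qed

lemma partial_derivation:
  fixes X :: "('n \<Rightarrow> 'k :: field_char_0) set"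
  shows "partial (Inr i) \<in> derivations (cylinder X :: ('n + 'm :: finite \<Rightarrow> 'k) set)"
proof -
  let ?R = "coord_ring (cylinder X :: ('n + 'm \<Rightarrow> 'k) set)"
  let ?D = "partial (Inr i) :: ('n + 'm, 'k) operator"
  have *: "?D (g + h) z = (?D g + ?D h) z \<and> ?D (g * h) z = (?D g * h + g * ?D h) z
      \<and> ?D (scale c g) z = scale c (?D g) z" if gh: "g \<in> ?R" "h \<in> ?R" for g h z c
  proof -
    obtain p q where "\<forall>t. poly p t = g (z(Inr i := t))" "\<forall>t. poly q t = h (z(Inr i := t))"
      using polynomial_on_line[OF gh(1), of z i] polynomial_on_line[OF gh(2), of z i] by (elim exE)
    then have p: "poly p t = g (z(Inr i := t))" and q: "poly q t = h (z(Inr i := t))" for t by auto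
    have eq: "?D g z = poly (pderiv p) (z (Inr i))" "?D h z = poly (pderiv q) (z (Inr i))"
      "?D (g + h) z = poly (pderiv (p + q)) (z (Inr i))"
      "?D (g * h) z = poly (pderiv (p * q)) (z (Inr i))"
      "?D (scale c g) z = poly (pderiv (smult c p)) (z (Inr i))"
      by (rule partial_eq; simp add: p q scale_def del: fun_upd_apply)+
    have "g z = poly p (z (Inr i))" "h z = poly q (z (Inr i))" by (simp_all add: p q)
    then show ?thesis
      by (simp add: eq pderiv_add pderiv_mult pderiv_smult algebra_simps scale_apply)
  qed
  have sum_rule: "?D (g + h) = ?D g + ?D h" and product_rule: "?D (g * h) = ?D g * h + g * ?D h"
    and scale_rule: "?D (scale c g) = scale c (?D g)" if "g \<in> ?R" "h \<in> ?R" for g h c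
    using *[OF that] by (auto intro!: ext)
  have "?D h \<in> ?R" if "h \<in> ?R" for h
    using that
  proof (induction rule: coord_ring_cylinder_induct)
    case (pullback a)
    show ?case by (simp only: partial_pullback coord_ring_zero)
  next
    case (coord j)
    show ?case by (simp only: partial_y_monomial coord_ring_scale y_monomial_closed)
  next
    case (add g h)
    have "?D (g + h) \<in> ?R"
      unfolding sum_rule[OF add.hyps]
      by (rule coord_ring_add[OF add.IH])
    then show ?case .
  next
    case (mult g h)
    have "?D (g * h) \<in> ?R"
      unfolding product_rule[OF mult.hyps]
      by (intro coord_ring_add coord_ring_mult mult.IH mult.hyps)
    then show ?case .
  qed
  then show ?thesis unfolding derivations_def using sum_rule product_rule scale_rule by simp
qed

lemma derivation_combination:
  assumes D: "D \<in> derivations Z" "D' \<in> derivations Z" and AB: "A \<in> coord_ring Z" "B \<in> coord_ring Z"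
  shows "(\<lambda>h. A * D h + B * D' h) \<in> derivations Z"
  unfolding derivations_def
proof (intro CollectI conjI ballI allI)
  show "(\<lambda>h. A * D h + B * D' h) \<in> coord_ring Z \<rightarrow> coord_ring Z"
  proof
    fix h assume "h \<in> coord_ring Z"
    then show "A * D h + B * D' h \<in> coord_ring Z"
      using AB derivation_closed[OF D(1)] derivation_closed[OF D(2)]
      by (simp add: coord_ring_add coord_ring_mult)
  qed
  fix a c assume a: "a \<in> coord_ring Z"
  show "A * D (scale c a) + B * D' (scale c a) = scale c (A * D a + B * D' a)"
    unfolding derivation_scale[OF D(1) a] derivation_scale[OF D(2) a]
    by (rule ext) (simp add: scale_def algebra_simps)
  fix b assume b: "b \<in> coord_ring Z"
  show "A * D (a + b) + B * D' (a + b) = A * D a + B * D' a + (A * D b + B * D' b)"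
    unfolding derivation_add[OF D(1) a b] derivation_add[OF D(2) a b] by (simp add: algebra_simps)
  show "A * D (a * b) + B * D' (a * b) = (A * D a + B * D' a) * b + a * (A * D b + B * D' b)"
    unfolding derivation_mult[OF D(1) a b] derivation_mult[OF D(2) a b] by (simp add: algebra_simps)
qed


section \<open>Derivations of a suspension\<close>

text \<open>
  On \<open>\<K>[X][y]\<close> this is the derivation with \<open>a \<mapsto> \<partial>(y\<^sup>k)/\<partial>y\<^sub>i \<delta>(a)\<close> on \<open>\<K>[X]\<close>, \<open>y\<^sub>i \<mapsto> \<delta>(f)\<close>, and \<open>y\<^sub>j \<mapsto> 0\<close> for
  \<open>j \<noteq> i\<close>. With \<open>P = y\<^sup>k - f\<close> it is \<open>\<partial>\<^sub>i(P) \<delta> - \<delta>(P) \<partial>\<^sub>i\<close>, which visibly kills \<open>P\<close>.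
\<close>

definition susp_derivation :: "('n \<Rightarrow> 'k :: field_char_0) set \<Rightarrow> (('n \<Rightarrow> 'k) \<Rightarrow> 'k) \<Rightarrow>
    ('m :: finite \<Rightarrow> nat) \<Rightarrow> 'm \<Rightarrow> ('n, 'k) operator \<Rightarrow> ('n + 'm, 'k) operator" where
  "susp_derivation X f k i \<delta> h =
     partial (Inr i) (y_monomial X k) * fibrewise \<delta> h + pullback (\<delta> f) * partial (Inr i) h"

lemma nilpotent_y_monomial:
  fixes D :: "('n + 'm :: finite, 'k :: comm_ring_1) operator"
  assumes D: "D \<in> derivations (cylinder X)"
    and i: "\<exists>N. (D ^^ N) (y_monomial X (unit_exponent i)) = 0"
    and 0: "\<exists>N. (D ^^ N) (y_monomial X (\<alpha>(i := 0))) = 0"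
  shows "\<exists>N. (D ^^ N) (y_monomial X (\<alpha>(i := n))) = 0"
proof (induction n)
  case (Suc n)
  show ?case unfolding y_monomial_upd_Suc[of X \<alpha> i n]
    by (rule nilpotent_mult[OF D y_monomial_closed y_monomial_closed Suc.IH i])
qed (rule 0)

context
  fixes X :: "('n \<Rightarrow> 'k :: field_char_0) set" and f :: "('n \<Rightarrow> 'k) \<Rightarrow> 'k"
    and k :: "'m :: finite \<Rightarrow> nat" and i :: 'm and \<delta> :: "('n, 'k) operator"
  assumes \<delta>: "\<delta> \<in> LND X" and f: "f \<in> coord_ring X"
begin

private abbreviation "R \<equiv> coord_ring (cylinder X :: ('n + 'm \<Rightarrow> 'k) set)"
private abbreviation "D \<equiv> susp_derivation X f k i \<delta>"
private abbreviation "dP \<equiv> partial (Inr i) (y_monomial X k)"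

lemma dP_closed: "dP \<in> R"
  by (simp only: partial_y_monomial coord_ring_scale y_monomial_closed)

lemma susp_derivation: "D \<in> derivations (cylinder X)"
proof -
  have "\<delta> f \<in> coord_ring X" by (rule derivation_closed[OF LND_derivation[OF \<delta>] f])
  then have "(\<lambda>h. dP * fibrewise \<delta> h + pullback (\<delta> f) * partial (Inr i) h) \<in> derivations (cylinder X)"
    by (intro derivation_combination fibrewise_derivation partial_derivation dP_closed
        coord_ring_pullback LND_derivation[OF \<delta>])
  moreover have "D = (\<lambda>h. dP * fibrewise \<delta> h + pullback (\<delta> f) * partial (Inr i) h)"
    by (rule ext) (simp only: susp_derivation_def)
  ultimately show ?thesis by simp
qed

lemma susp_derivation_pullback: "D (pullback a) = dP * pullback (\<delta> a)"
  by (simp only: susp_derivation_def fibrewise_pullback[OF LND_derivation[OF \<delta>]] partial_pullback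
      mult_zero_right add_0_right)

lemma susp_derivation_y_monomial:
  "D (y_monomial X \<alpha>) =
     pullback (\<delta> f) * scale (of_nat (\<alpha> i)) (y_monomial X (\<alpha>(i := \<alpha> i - 1)))"
  by (simp only: susp_derivation_def fibrewise_y_monomial[OF LND_derivation[OF \<delta>]] partial_y_monomial
      mult_zero_right add_0_left)

lemma susp_derivation_susp_eq: "D (susp_eq X f k) = 0"
proof -
  have "y_monomial X k = susp_eq X f k + pullback f"
  proof
    fix z :: "'n + 'm \<Rightarrow> 'k"
    show "y_monomial X k z = (susp_eq X f k + pullback f) z"
      using coord_ring_outside[OF f]
      by (simp add: y_monomial_def susp_eq_def on_var_def mono_fun_def pullback_def cylinder_def)
  qed
  then have "D (y_monomial X k) = D (susp_eq X f k) + D (pullback f)"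
    by (simp only: derivation_add[OF susp_derivation coord_ring_susp_eq[OF f] coord_ring_pullback[OF f]])
  moreover have "D (y_monomial X k) = D (pullback f)"
    by (simp only: susp_derivation_y_monomial susp_derivation_pullback partial_y_monomial mult.commute)
  ultimately show ?thesis by simp
qed

text \<open>
  If \<open>k i = 1\<close>, then \<open>\<partial>(y\<^sup>k)/\<partial>y\<^sub>i\<close> does not involve \<open>y\<^sub>i\<close> and lies in the kernel. If \<open>\<delta>\<^sup>2(f) = 0\<close>, then
  \<open>y\<^sub>i \<mapsto> \<delta>(f) \<mapsto> 0\<close>. In both cases \<open>\<partial>(y\<^sup>k)/\<partial>y\<^sub>i\<close> is nilpotent, and nilpotency of \<open>a \<in> \<K>[X]\<close> follows by
  induction on the order of \<open>\<delta>\<close> at \<open>a\<close>.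
\<close>

lemma susp_derivation_nilpotent:
  assumes i: "k i = 1 \<or> \<delta> (\<delta> f) = 0" and h: "h \<in> R"
  shows "\<exists>N. (D ^^ N) h = 0"
proof -
  note D = susp_derivation
  let ?nil = "\<lambda>h. \<exists>N. (D ^^ N) h = 0"
  have zero: "?nil 0" by (rule exI[of _ 0]) simp
  have other: "?nil (y_monomial X \<alpha>)" if "\<alpha> i = 0" for \<alpha>
  proof (rule nilpotent_if_image_nilpotent)
    have "D (y_monomial X \<alpha>) = 0"
      by (rule ext) (simp add: susp_derivation_y_monomial that scale_def)
    then show "?nil (D (y_monomial X \<alpha>))" using zero by (simp only:)
  qed
  have \<delta>f: "\<delta> f \<in> coord_ring X" by (rule derivation_closed[OF LND_derivation[OF \<delta>] f])
  have y_i: "?nil (y_monomial X (unit_exponent i))" if "?nil (pullback (\<delta> f))"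
  proof (rule nilpotent_if_image_nilpotent)
    have "D (y_monomial X (unit_exponent i)) = pullback (\<delta> f) * y_monomial X ((unit_exponent i)(i := 0))"
      by (simp add: susp_derivation_y_monomial scale_def)
    moreover have "?nil (y_monomial X ((unit_exponent i)(i := 0)))" by (rule other) simp
    ultimately show "?nil (D (y_monomial X (unit_exponent i)))"
      by (simp only: nilpotent_mult[OF D coord_ring_pullback[OF \<delta>f] y_monomial_closed that])
  qed
  have "?nil (y_monomial X (k(i := k i - 1)))"
  proof (cases "k i = 1")
    case True
    then show ?thesis by (intro other) simp
  next
    case False
    then have "\<delta> (\<delta> f) = 0" using i by simp
    then have "D (pullback (\<delta> f)) = 0"
      by (simp only: susp_derivation_pullback) (rule ext, simp add: pullback_def)
    then have "?nil (D (pullback (\<delta> f)))" using zero by (simp only:)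
    then have "?nil (y_monomial X (unit_exponent i))"
      by (rule y_i[OF nilpotent_if_image_nilpotent])
    then show ?thesis by (rule nilpotent_y_monomial[OF D _ other]) simp
  qed
  then obtain N where N: "(D ^^ N) (y_monomial X (k(i := k i - 1))) = 0" by (rule exE)
  have "(D ^^ N) dP = scale (of_nat (k i)) 0"
    unfolding partial_y_monomial derivation_iterate_scale[OF D y_monomial_closed] N by (rule refl)
  then have dP: "?nil dP" by (intro exI[of _ N]) (simp only: scale_zero)
  have "?nil (pullback a)" if "(\<delta> ^^ n) a = 0" "a \<in> coord_ring X" for n a
    using that
  proof (induction n arbitrary: a)
    case 0
    then have "a = 0" by (simp only: funpow.simps id_apply)
    then have "(pullback a :: ('n + 'm \<Rightarrow> 'k) \<Rightarrow> 'k) = 0" by (simp add: pullback_def zero_fun_def)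
    then show ?case using zero by (simp only:)
  next
    case (Suc n)
    have \<delta>a: "\<delta> a \<in> coord_ring X" by (rule derivation_closed[OF LND_derivation[OF \<delta>] Suc.prems(2)])
    have "?nil (pullback (\<delta> a))"
      by (rule Suc.IH[OF _ \<delta>a]) (use Suc.prems(1) in \<open>simp only: funpow_Suc_right o_apply\<close>)
    then have "?nil (dP * pullback (\<delta> a))"
      by (rule nilpotent_mult[OF D dP_closed coord_ring_pullback[OF \<delta>a] dP])
    then have "?nil (D (pullback a))" by (simp only: susp_derivation_pullback)
    then show ?case by (rule nilpotent_if_image_nilpotent)
  qed
  then have base: "?nil (pullback a)" if "a \<in> coord_ring X" for a
    using LND_nilpotent[OF \<delta> that] that by (elim exE) 
  show ?thesis using h
  proof (induction rule: coord_ring_cylinder_induct)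
    case (pullback a)
    then show ?case by (rule base)
  next
    case (coord j)
    show ?case
    proof (cases "j = i")
      case True
      show ?thesis unfolding True by (rule y_i[OF base[OF \<delta>f]])
    next
      case False
      show ?thesis by (rule other) (use False in simp)
    qed
  next
    case (add g h)
    show ?case by (rule nilpotent_add[OF D add.hyps add.IH])
  next
    case (mult g h)
    show ?case by (rule nilpotent_mult[OF D mult.hyps mult.IH])
  qed
qed

end

text \<open>
  The kernel of the restriction to the suspension is generated by \<open>y\<^sup>k - f\<close>, which is killed; so it is
  preserved.
\<close>

lemma susp_LND:
  fixes X :: "('n \<Rightarrow> 'k :: {alg_closed_field, field_char_0}) set" and k :: "'m :: finite \<Rightarrow> nat"
  assumes irr: "zariski_irreducible X" and f: "f \<in> coord_ring X - scalars X" and k: "\<And>j. k j > 0"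
    and \<delta>: "\<delta> \<in> LND X" and i: "k i = 1 \<or> \<delta> (\<delta> f) = 0"
  obtains E where "E \<in> LND (Susp X f k)"
    "\<And>h. h \<in> coord_ring (cylinder X) \<Longrightarrow>
       E (on_var (Susp X f k) h) = on_var (Susp X f k) (susp_derivation X f k i \<delta> h)"
proof (rule LND_descend)
  have f': "f \<in> coord_ring X" using f by simp
  show D: "susp_derivation X f k i \<delta> \<in> derivations (cylinder X)" by (rule susp_derivation[OF \<delta> f'])
  show "Susp X f k \<subseteq> cylinder X" by (auto simp: Susp_def)
  show "\<exists>n. (susp_derivation X f k i \<delta> ^^ n) h = 0" if "h \<in> coord_ring (cylinder X)" for h
    by (rule susp_derivation_nilpotent[where X = X and f = f and k = k and i = i and \<delta> = \<delta>, OF \<delta> f' i that])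
  show "on_var (Susp X f k) (susp_derivation X f k i \<delta> h) = 0"
    if h: "h \<in> coord_ring (cylinder X)" "on_var (Susp X f k) h = 0" for h
  proof -
    have "h \<in> {h \<in> coord_ring (cylinder X). on_var (Susp X f k) h = 0}" using h by simp
    then obtain g where g: "h = susp_eq X f k * g" "g \<in> coord_ring (cylinder X)"
      unfolding kernel_on_var_Susp[OF irr f k] by (elim CollectE exE conjE)
    have "susp_derivation X f k i \<delta> h = susp_eq X f k * susp_derivation X f k i \<delta> g"
      unfolding g(1) derivation_mult[OF D coord_ring_susp_eq[OF f'] g(2)] susp_derivation_susp_eq[OF \<delta> f']
      by simp
    then show ?thesis by (auto simp: on_var_def susp_eq_def Susp_def fun_eq_iff)
  qed
qed (rule that)

text \<open>
  After multiplication by \<open>y\<^sub>i\<close> both terms of the derivation become multiples of the same monomial, by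
  \<open>y\<^sub>i \<partial>\<^sub>i(y\<^sup>\<beta>) = \<beta>\<^sub>i y\<^sup>\<beta>\<close> for \<open>\<beta> = k\<close> and \<open>\<beta> = \<alpha>\<close>, and by \<open>y\<^sup>k = f\<close> on the suspension.
\<close>

lemma y_times_susp_derivation:
  fixes X :: "('n \<Rightarrow> 'k :: field_char_0) set" and k :: "'m :: finite \<Rightarrow> nat"
  assumes \<delta>: "\<delta> \<in> LND X" and f: "f \<in> coord_ring X" and a: "a \<in> coord_ring X"
    and z: "z \<in> Susp X f k"
  shows "z (Inr i) * susp_derivation X f k i \<delta> (pullback a * y_monomial X \<alpha>) z =
    (of_nat (k i) * (\<delta> a * f) (z \<circ> Inl) + of_nat (\<alpha> i) * (a * \<delta> f) (z \<circ> Inl)) * mono_fun \<alpha> (z \<circ> Inr)"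
proof -
  have zX: "z \<in> cylinder X" and P: "mono_fun k (z \<circ> Inr) = f (z \<circ> Inl)"
    using z by (simp_all add: Susp_def mono_fun_def)
  have y: "z (Inr i) * (of_nat (\<beta> i) * y_monomial X (\<beta>(i := \<beta> i - 1)) z) = of_nat (\<beta> i) * mono_fun \<beta> (z \<circ> Inr)"
    for \<beta>
  proof (cases "\<beta> i")
    case (Suc n)
    then have "\<beta>(i := Suc n) = \<beta>" by (simp add: fun_eq_iff)
    then show ?thesis
      using Suc mono_fun_upd_exponent[of \<beta> i "Suc n" "z \<circ> Inr"] mono_fun_upd_exponent[of \<beta> i n "z \<circ> Inr"] zX
      by (simp add: y_monomial_def on_var_def)
  qed simp
  have "susp_derivation X f k i \<delta> (pullback a * y_monomial X \<alpha>) =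
      partial (Inr i) (y_monomial X k) * pullback (\<delta> a) * y_monomial X \<alpha> +
      pullback a * (pullback (\<delta> f) * scale (of_nat (\<alpha> i)) (y_monomial X (\<alpha>(i := \<alpha> i - 1))))"
    by (simp only: derivation_mult[OF susp_derivation[OF \<delta> f] coord_ring_pullback[OF a] y_monomial_closed]
        susp_derivation_pullback[OF \<delta> f] susp_derivation_y_monomial[OF \<delta> f])
  then have "z (Inr i) * susp_derivation X f k i \<delta> (pullback a * y_monomial X \<alpha>) z =
      z (Inr i) * (of_nat (k i) * y_monomial X (k(i := k i - 1)) z) * \<delta> a (z \<circ> Inl) * mono_fun \<alpha> (z \<circ> Inr) +
      a (z \<circ> Inl) * \<delta> f (z \<circ> Inl) * (z (Inr i) * (of_nat (\<alpha> i) * y_monomial X (\<alpha>(i := \<alpha> i - 1)) z))"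
    using zX by (simp add: partial_y_monomial scale_apply pullback_def algebra_simps)
      (simp add: y_monomial_def on_var_def)
  then show ?thesis unfolding y P by (simp add: algebra_simps)
qed


section \<open>The Makar-Limanov invariant of a suspension\<close>

text \<open>
  Each fibre over a point with \<open>f \<noteq> 0\<close> is a torsor under \<open>{t. t\<^sup>k = 1}\<close>, so the monomials of a normal
  form are linearly independent on it, and the relation splits into its components. A relation
  proved where \<open>f \<noteq> 0\<close> extends to all of \<open>X\<close> because \<open>\<K>[X]\<close> is a domain.
\<close>

lemma kernel_componentwise:
  fixes X :: "('n \<Rightarrow> 'k :: {alg_closed_field, field_char_0}) set" and k :: "'m :: finite \<Rightarrow> nat"
  assumes irr: "zariski_irreducible X" and f: "f \<in> coord_ring X" "f \<noteq> 0" and k: "\<And>j. k j > 0"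
    and \<delta>: "\<delta> \<in> LND X"
    and S: "finite S" "\<And>\<alpha>. \<alpha> \<in> S \<Longrightarrow> \<not> k \<le> \<alpha>" "\<And>\<alpha>. \<alpha> \<in> S \<Longrightarrow> a \<alpha> \<in> coord_ring X"
    and ker: "on_var (Susp X f k) (susp_derivation X f k i \<delta> (\<Sum>\<alpha>\<in>S. pullback (a \<alpha>) * y_monomial X \<alpha>)) = 0"
    and \<beta>: "\<beta> \<in> S"
  shows "scale (of_nat (k i)) (\<delta> (a \<beta>) * f) + scale (of_nat (\<beta> i)) (a \<beta> * \<delta> f) = 0"
proof -
  define c where "c \<alpha> = scale (of_nat (k i)) (\<delta> (a \<alpha>) * f) + scale (of_nat (\<alpha> i)) (a \<alpha> * \<delta> f)" for \<alpha>
  have sum_apply: "(\<Sum>\<alpha>\<in>T. F \<alpha>) z = (\<Sum>\<alpha>\<in>T. F \<alpha> z)" for F :: "('m \<Rightarrow> nat) \<Rightarrow> ('n + 'm \<Rightarrow> 'k) \<Rightarrow> 'k" and T z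
    by (induction T rule: infinite_finite_induct) auto
  have D: "susp_derivation X f k i \<delta> (\<Sum>\<alpha>\<in>S. pullback (a \<alpha>) * y_monomial X \<alpha>) =
      (\<Sum>\<alpha>\<in>S. susp_derivation X f k i \<delta> (pullback (a \<alpha>) * y_monomial X \<alpha>))"
    by (rule derivation_sum[OF susp_derivation[OF \<delta> f(1)]])
      (intro coord_ring_mult coord_ring_pullback y_monomial_closed S(3))
  have "c \<beta> x = 0" if x: "x \<in> X" "f x \<noteq> 0" for x
  proof -
    obtain y :: "'m \<Rightarrow> 'k" where y: "mono_fun k y = f x" using mono_fun_root[where c = "f x", OF k] by (rule exE)
    have "c \<beta> x * mono_fun \<beta> y = 0"
    proof (rule characters_independent[where S = S and T = "{t. mono_fun k t = 1}" and m = "(*)"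
          and e = 1 and \<chi> = mono_fun and c = "\<lambda>\<alpha>. c \<alpha> x * mono_fun \<alpha> y"])
      fix t :: "'m \<Rightarrow> 'k" assume t: "t \<in> {t. mono_fun k t = 1}"
      define z where "z = case_sum x (y * t)"
      have zx: "z \<circ> Inl = x" and zy: "z \<circ> Inr = y * t" by (simp_all add: z_def case_sum_comp)
      have "(\<Prod>j\<in>UNIV. z (Inr j) ^ k j) = mono_fun k (z \<circ> Inr)" by (simp add: mono_fun_def)
      also have "\<dots> = f x" using y t by (simp add: zy mono_fun_times)
      finally have z: "z \<in> Susp X f k" using x by (simp add: Susp_def cylinder_def zx)
      have "0 = susp_derivation X f k i \<delta> (\<Sum>\<alpha>\<in>S. pullback (a \<alpha>) * y_monomial X \<alpha>) z"
        using fun_cong[OF ker, of z] z by (simp add: on_var_def)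
      also have "\<dots> = (\<Sum>\<alpha>\<in>S. susp_derivation X f k i \<delta> (pullback (a \<alpha>) * y_monomial X \<alpha>) z)"
        unfolding D by (rule sum_apply)
      finally have "0 = z (Inr i) * (\<Sum>\<alpha>\<in>S. susp_derivation X f k i \<delta> (pullback (a \<alpha>) * y_monomial X \<alpha>) z)"
        by simp
      also have "\<dots> = (\<Sum>\<alpha>\<in>S. c \<alpha> x * mono_fun \<alpha> (z \<circ> Inr))"
        unfolding sum_distrib_left
        by (intro sum.cong refl)
          (simp only: y_times_susp_derivation[OF \<delta> f(1) S(3) z] c_def plus_fun_apply scale_apply zx)
      finally show "(\<Sum>\<alpha>\<in>S. c \<alpha> x * mono_fun \<alpha> y * mono_fun \<alpha> t) = 0"
        by (simp add: zy mono_fun_times mult.assoc)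
    next
      fix s s' assume "s \<in> S" "s' \<in> S" "s \<noteq> s'"
      then show "\<exists>t\<in>{t :: 'm \<Rightarrow> 'k. mono_fun k t = 1}. mono_fun s t \<noteq> mono_fun s' t"
        using mono_fun_separate[where k = k and \<alpha> = s and \<beta> = s' and 'k = 'k, OF k] S(2) by blast
    qed (use S(1) \<beta> in \<open>auto simp: mono_fun_times mono_fun_one\<close>)
    moreover have "mono_fun \<beta> y \<noteq> 0" by (rule mono_fun_neq_0[where k = k, OF _ k]) (simp add: y x)
    ultimately show ?thesis by simp
  qed
  then have "f * c \<beta> = 0" using coord_ring_outside[OF f(1)] by (intro ext) fastforce
  moreover have "c \<beta> \<in> coord_ring X"
    unfolding c_def using derivation_closed[OF LND_derivation[OF \<delta>]] S(3)[OF \<beta>] f(1)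
    by (simp add: coord_ring_add coord_ring_mult coord_ring_scale)
  ultimately have "c \<beta> = 0" using coord_ring_integral[OF irr f(1)] f(2) by blast
  then show ?thesis by (simp only: c_def)
qed

text \<open>
  The hypothesis says that \<open>p\<^sup>l q\<^sup>m\<close> has derivative zero; in characteristic zero it is constant, and then
  so is \<open>q\<close>.
\<close>

lemma logarithmic_derivative_zero:
  fixes p q :: "'k :: field_char_0 poly"
  assumes "smult (of_nat l) (pderiv p * q) + smult (of_nat m) (p * pderiv q) = 0"
    and "l > 0" "m > 0" "p \<noteq> 0"
  shows "pderiv q = 0"
proof (cases "q = 0")
  case False
  obtain l' m' where lm: "l = Suc l'" "m = Suc m'" using assms(2,3) by (meson gr0_implies_Suc)
  have "pderiv (p ^ l * q ^ m) =
      p ^ l' * q ^ m' * (smult (of_nat l) (pderiv p * q) + smult (of_nat m) (p * pderiv q))"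
    unfolding pderiv_mult lm pderiv_power_Suc by (simp add: algebra_simps)
  then have "degree (p ^ l * q ^ m) = 0" by (simp add: assms(1) flip: pderiv_eq_0_iff)
  then have "degree q = 0" using False assms(3,4) by (simp add: degree_mult_eq degree_power_eq)
  then show ?thesis by (simp only: pderiv_eq_0_iff)
qed simp

text \<open>
  Along a generic orbit the relation is one between polynomials in one variable, where it would force
  \<open>f\<close> to be constant on the orbit.
\<close>

lemma positive_weight_vanishes:
  fixes X :: "('n \<Rightarrow> 'k :: field_char_0) set"
  assumes irr: "zariski_irreducible X" and \<delta>: "\<delta> \<in> LND X"
    and af: "a \<in> coord_ring X" "f \<in> coord_ring X" and "\<delta> f \<noteq> 0" and lm: "l > 0" "m > 0"
    and rel: "scale (of_nat l) (\<delta> a * f) + scale (of_nat m) (a * \<delta> f) = 0"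
  shows "a = 0"
proof (rule ccontr)
  assume "a \<noteq> 0"
  have closed: "\<delta> a \<in> coord_ring X" "\<delta> f \<in> coord_ring X"
    using derivation_closed[OF LND_derivation[OF \<delta>]] af by auto
  have "a * \<delta> f \<noteq> 0"
    using coord_ring_integral[OF irr af(1) closed(2)] \<open>a \<noteq> 0\<close> \<open>\<delta> f \<noteq> 0\<close> by blast
  then obtain x where x: "a x \<noteq> 0" "\<delta> f x \<noteq> 0" by (auto simp: fun_eq_iff)
  let ?p = "taylor \<delta> x a" and ?q = "taylor \<delta> x f"
  have "taylor \<delta> x (scale (of_nat l) (\<delta> a * f) + scale (of_nat m) (a * \<delta> f)) =
      smult (of_nat l) (pderiv ?p * ?q) + smult (of_nat m) (?p * pderiv ?q)"
    using af closed
    by (simp add: taylor_add[OF \<delta>] taylor_scale[OF \<delta>] taylor_mult[OF \<delta>] pderiv_taylor[OF \<delta>]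
        coord_ring_mult coord_ring_scale)
  then have eq: "smult (of_nat l) (pderiv ?p * ?q) + smult (of_nat m) (?p * pderiv ?q) = 0"
    by (simp only: rel taylor_zero[OF \<delta>])
  have "?p \<noteq> 0" using x(1) poly_taylor_0[OF \<delta> af(1), of x] by auto
  then have "pderiv ?q = 0" by (rule logarithmic_derivative_zero[OF eq lm])
  then show False using x(2) poly_taylor_0[OF \<delta> closed(2), of x] by (simp add: pderiv_taylor[OF \<delta> af(2)])
qed

text \<open>
  The element \<open>b\<close> is the component of weight \<open>0\<close> in the normal form of \<open>h\<close>; a single \<open>\<epsilon>\<close> with
  \<open>\<epsilon>(f) \<noteq> 0\<close> that can be lifted in all directions \<open>y\<^sub>i\<close> rules out the other components.
\<close>

lemma makar_limanov_Susp:
  fixes X :: "('n \<Rightarrow> 'k :: {alg_closed_field, field_char_0}) set" and k :: "'m :: finite \<Rightarrow> nat"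
  assumes irr: "zariski_irreducible X" and f: "f \<in> coord_ring X - scalars X" and k: "\<And>j. k j > 0"
    and \<epsilon>: "\<epsilon> \<in> LND X" "\<epsilon> f \<noteq> 0" "\<And>i. k i = 1 \<or> \<epsilon> (\<epsilon> f) = 0"
    and h: "h \<in> makar_limanov (Susp X f k)"
  obtains b where "b \<in> coord_ring X" "h = on_var (Susp X f k) (pullback b)"
    "\<And>\<delta> i. \<delta> \<in> LND X \<Longrightarrow> k i = 1 \<or> \<delta> (\<delta> f) = 0 \<Longrightarrow> \<delta> b = 0"
proof -
  let ?\<pi> = "on_var (Susp X f k) :: (('n + 'm \<Rightarrow> 'k) \<Rightarrow> 'k) \<Rightarrow> _"
  have f': "f \<in> coord_ring X" using f by simp
  have "f \<noteq> 0"
  proof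
    assume "f = 0"
    then have "f = on_var X (\<lambda>_. 0)" by (simp add: on_var_def zero_fun_def)
    then show False using f by (auto simp: scalars_def)
  qed
  have kill: "E h = 0" "h \<in> coord_ring (Susp X f k)" if "E \<in> LND (Susp X f k)" for E
    using INT_D[OF h[unfolded makar_limanov_def] that] by (simp_all add: Ker_def)
  (* An intersection over no derivations would be the set of all functions; the lift of \<epsilon> in an
     arbitrary direction excludes this. *)
  obtain E where "E \<in> LND (Susp X f k)" by (rule susp_LND[where k = k and \<delta> = \<epsilon> and i = undefined, OF irr f k \<epsilon>(1) \<epsilon>(3)])
  then have "h \<in> coord_ring (Susp X f k)" by (rule kill(2))
  then obtain h' where h': "h' \<in> coord_ring (cylinder X)" "h = ?\<pi> h'"
    unfolding coord_ring_Susp[symmetric] by (elim imageE)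
  obtain g S a where nf: "finite S" "\<forall>\<alpha>\<in>S. \<not> k \<le> \<alpha> \<and> a \<alpha> \<in> coord_ring X"
    "\<forall>z\<in>cylinder X. h' z = susp_eq X f k z * g z + (\<Sum>\<alpha>\<in>S. a \<alpha> (z \<circ> Inl) * mono_fun \<alpha> (z \<circ> Inr))"
    using normal_form_exists[where k = k, OF k f' h'(1)] unfolding normal_form_def by (elim exE conjE)
  define H :: "('n + 'm \<Rightarrow> 'k) \<Rightarrow> 'k" where "H = (\<Sum>\<alpha>\<in>S. pullback (a \<alpha>) * y_monomial X \<alpha>)"
  have S: "\<And>\<alpha>. \<alpha> \<in> S \<Longrightarrow> \<not> k \<le> \<alpha>" "\<And>\<alpha>. \<alpha> \<in> S \<Longrightarrow> a \<alpha> \<in> coord_ring X" using nf(2) by simp_all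
  have H: "H \<in> coord_ring (cylinder X)"
    unfolding H_def by (intro coord_ring_sum coord_ring_mult coord_ring_pullback y_monomial_closed S(2))
  have hH: "h = ?\<pi> H"
  proof
    fix z :: "'n + 'm \<Rightarrow> 'k"
    have "sum F T z = (\<Sum>\<alpha>\<in>T. F \<alpha> z)" for F :: "('m \<Rightarrow> nat) \<Rightarrow> ('n + 'm \<Rightarrow> 'k) \<Rightarrow> 'k" and T
      by (induction T rule: infinite_finite_induct) auto
    then have "H z = (\<Sum>\<alpha>\<in>S. a \<alpha> (z \<circ> Inl) * mono_fun \<alpha> (z \<circ> Inr))" if "z \<in> cylinder X"
      using that by (simp add: H_def pullback_def y_monomial_def on_var_def)
    then show "h z = ?\<pi> H z"
      using nf(3) by (auto simp: h'(2) on_var_def Susp_def susp_eq_def)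
  qed
  have component: "scale (of_nat (k i)) (\<delta> (a \<alpha>) * f) + scale (of_nat (\<alpha> i)) (a \<alpha> * \<delta> f) = 0"
    if \<delta>: "\<delta> \<in> LND X" "k i = 1 \<or> \<delta> (\<delta> f) = 0" and \<alpha>: "\<alpha> \<in> S" for \<delta> i \<alpha>
  proof -
    obtain E where E: "E \<in> LND (Susp X f k)"
      "\<And>h. h \<in> coord_ring (cylinder X) \<Longrightarrow> E (?\<pi> h) = ?\<pi> (susp_derivation X f k i \<delta> h)"
      by (rule susp_LND[where k = k and \<delta> = \<delta> and i = i, OF irr f k \<delta>]) (rule that)
    have ker: "?\<pi> (susp_derivation X f k i \<delta> H) = 0"
      using E(2)[OF H] kill(1)[OF E(1)] by (simp add: hH)
    show ?thesis
      by (rule kernel_componentwise[where k = k and \<delta> = \<delta> and a = a, OF irr f' \<open>f \<noteq> 0\<close> k \<delta>(1) nf(1) S ker[unfolded H_def] \<alpha>])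
  qed
  have vanish: "a \<alpha> = 0" if \<alpha>: "\<alpha> \<in> S" "\<alpha> \<noteq> (\<lambda>_. 0)" for \<alpha>
  proof -
    obtain i where "\<alpha> i > 0" using \<alpha>(2) by (auto simp: fun_eq_iff)
    then show ?thesis
      by (rule positive_weight_vanishes[where \<delta> = \<epsilon>, OF irr \<epsilon>(1) S(2)[OF \<alpha>(1)] f' \<epsilon>(2) k _ component[where \<delta> = \<epsilon>, OF \<epsilon>(1,3) \<alpha>(1)]])
  qed
  define b where "b = (if (\<lambda>_. 0) \<in> S then a (\<lambda>_. 0) else 0)"
  have b: "b \<in> coord_ring X" using S(2) by (simp add: b_def coord_ring_zero)
  have "?\<pi> H = ?\<pi> (pullback b)"
  proof -
    have zero: "(pullback 0 :: ('n + 'm \<Rightarrow> 'k) \<Rightarrow> 'k) = 0" by (simp add: pullback_def zero_fun_def)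
    have "H = (\<Sum>\<alpha>\<in>S. if \<alpha> = (\<lambda>_. 0) then pullback b * y_monomial X (\<lambda>_. 0) else 0)"
      unfolding H_def
    proof (rule sum.cong)
      fix \<alpha> assume \<alpha>: "\<alpha> \<in> S"
      show "pullback (a \<alpha>) * y_monomial X \<alpha> =
          (if \<alpha> = (\<lambda>_. 0) then pullback b * y_monomial X (\<lambda>_. 0) else 0)"
        using \<alpha> vanish[OF \<alpha>] by (cases "\<alpha> = (\<lambda>_. 0)") (simp_all add: b_def zero)
    qed simp
    also have "\<dots> = pullback b * y_monomial X (\<lambda>_. 0)"
      using nf(1) by (simp add: sum.delta b_def zero)
    finally have "H = pullback b * y_monomial X (\<lambda>_. 0)" .
    then show ?thesis
      by (intro ext) (simp add: on_var_def y_monomial_def mono_fun_def Susp_def)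
  qed
  moreover have "\<delta> b = 0" if \<delta>: "\<delta> \<in> LND X" "k i = 1 \<or> \<delta> (\<delta> f) = 0" for \<delta> i
  proof (cases "(\<lambda>_. 0) \<in> S")
    case True
    have "\<delta> b * f = 0"
    proof
      fix x
      show "(\<delta> b * f) x = 0 x"
        using fun_cong[OF component[where \<delta> = \<delta>, OF \<delta> True], of x] k[of i] True
        by (simp add: scale_apply b_def)
    qed
    moreover have "\<delta> b \<in> coord_ring X" by (rule derivation_closed[OF LND_derivation[OF \<delta>(1)] b])
    ultimately show ?thesis using coord_ring_integral[OF irr _ f'] \<open>f \<noteq> 0\<close> by blast
  next
    case False
    then show ?thesis by (simp add: b_def derivation_zero[OF LND_derivation[OF \<delta>(1)]])
  qed
  ultimately show ?thesis using b hH by (intro that) auto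
qed

theorem theorem3p1:
  fixes X :: "('n :: finite \<Rightarrow> 'k :: {alg_closed_field, field_char_0}) set"
    and f :: "('n \<Rightarrow> 'k) \<Rightarrow> 'k"
    and k :: "'m :: finite \<Rightarrow> nat"
  assumes "zariski_closed X" and "zariski_irreducible X"
    and "f \<in> coord_ring X - scalars X"
    and "\<And>j. k j > 0"
    and "zariski_irreducible (Susp X f k)"
  shows "((\<forall>j. k j = 1) \<and> f \<in> coord_ring X - makar_limanov X \<longrightarrow>
            makar_limanov (Susp X f k) \<subseteq> on_var (Susp X f k) ` pullback ` makar_limanov_at X f) \<and>
         ((\<exists>i j. k i = 1 \<and> k j > 1) \<and> local_slice X f \<longrightarrow>
            makar_limanov (Susp X f k) \<subseteq> on_var (Susp X f k) ` pullback ` makar_limanov_at X f) \<and>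
         ((\<forall>j. k j > 1) \<and> local_slice X f \<longrightarrow>
            makar_limanov (Susp X f k) \<subseteq> on_var (Susp X f k) ` pullback ` invariants X (G1 X f))"
proof (intro conjI impI subsetI)
  note lift = makar_limanov_Susp[where k = k, OF assms(2-4)]
  have f: "f \<in> coord_ring X" using assms(3) by simp
  have at: "b \<in> makar_limanov_at X f"
    if "b \<in> coord_ring X" "\<And>\<delta>. \<delta> \<in> LND X \<Longrightarrow> \<delta> b = 0" for b
    unfolding makar_limanov_at_def
  proof (rule INT_I)
    fix \<delta> assume "\<delta> \<in> {\<delta> \<in> LND X. \<delta> f \<noteq> 0}"
    then have "\<delta> \<in> LND X" by simp
    from that(2)[OF this] show "b \<in> Ker X \<delta>" using that(1) unfolding Ker_def by blast
  qed
  {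
    fix h
    assume *: "(\<forall>j. k j = 1) \<and> f \<in> coord_ring X - makar_limanov X"
      and h: "h \<in> makar_limanov (Susp X f k)"
    then obtain \<epsilon> where \<epsilon>: "\<epsilon> \<in> LND X" "\<epsilon> f \<noteq> 0" by (auto simp: makar_limanov_def Ker_def)
    have k1: "k j = 1" for j using * by simp
    obtain b where b: "b \<in> coord_ring X" "h = on_var (Susp X f k) (pullback b)"
      "\<And>\<delta> i. \<delta> \<in> LND X \<Longrightarrow> k i = 1 \<or> \<delta> (\<delta> f) = 0 \<Longrightarrow> \<delta> b = 0"
      by (rule lift[where \<epsilon> = \<epsilon>, OF \<epsilon> disjI1[OF k1] h]) (rule that)
    have "b \<in> makar_limanov_at X f" by (rule at[OF b(1)]) (rule b(3)[OF _ disjI1[OF k1]])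
    then show "h \<in> on_var (Susp X f k) ` pullback ` makar_limanov_at X f"
      unfolding b(2) by (intro imageI)
  next
    fix h
    assume *: "(\<exists>i j. k i = 1 \<and> k j > 1) \<and> local_slice X f"
      and h: "h \<in> makar_limanov (Susp X f k)"
    then obtain \<epsilon> where \<epsilon>: "\<epsilon> \<in> LND X" "\<epsilon> f \<noteq> 0" "\<epsilon> (\<epsilon> f) = 0" by (auto simp: local_slice_def)
    obtain i where i: "k i = 1" using * by auto
    obtain b where b: "b \<in> coord_ring X" "h = on_var (Susp X f k) (pullback b)"
      "\<And>\<delta> i. \<delta> \<in> LND X \<Longrightarrow> k i = 1 \<or> \<delta> (\<delta> f) = 0 \<Longrightarrow> \<delta> b = 0"
      by (rule lift[where \<epsilon> = \<epsilon>, OF \<epsilon>(1,2) disjI2[OF \<epsilon>(3)] h]) (rule that)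
    have "b \<in> makar_limanov_at X f" by (rule at[OF b(1)]) (rule b(3)[OF _ disjI1[OF i]])
    then show "h \<in> on_var (Susp X f k) ` pullback ` makar_limanov_at X f"
      unfolding b(2) by (intro imageI)
  next
    fix h
    assume *: "(\<forall>j. k j > 1) \<and> local_slice X f"
      and h: "h \<in> makar_limanov (Susp X f k)"
    then obtain \<epsilon> where \<epsilon>: "\<epsilon> \<in> LND X" "\<epsilon> f \<noteq> 0" "\<epsilon> (\<epsilon> f) = 0" by (auto simp: local_slice_def)
    obtain b where b: "b \<in> coord_ring X" "h = on_var (Susp X f k) (pullback b)"
      "\<And>\<delta> i. \<delta> \<in> LND X \<Longrightarrow> k i = 1 \<or> \<delta> (\<delta> f) = 0 \<Longrightarrow> \<delta> b = 0"
      by (rule lift[where \<epsilon> = \<epsilon>, OF \<epsilon>(1,2) disjI2[OF \<epsilon>(3)] h]) (rule that)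
    have "b \<in> invariants X (G1 X f)"
      by (rule kernels_subset_invariants_G1[OF f b(1)]) (rule b(3)[OF _ disjI2])
    then show "h \<in> on_var (Susp X f k) ` pullback ` invariants X (G1 X f)"
      unfolding b(2) by (intro imageI)
  }
qed

end
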